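(* For any integer $k\geq 1$, there is a $k$-parameter family of pairwise non-isomorphic connected and simply connected nilpotent Lie groups $N_{t_1,t_2,\dots,t_k}$ of dimension $4k+6$ such that every group $N_{t_1,\dots,t_k}$ of the family admits a $3$-parameter family of left-invariant Riemannian geodesic orbit metrics.
   Context: A Riemannian manifold $(M,g)$ is called a geodesic orbit manifold (and $g$ a geodesic orbit metric) if every geodesic of $(M,g)$ is an orbit of a $1$-parameter subgroup of the full isometry group of $(M,g)$. Metrics on nilpotent Lie groups are considered to be left-invariant Riemannian metrics. Families are continuous families depending on real parameters; Lie groups and Lie algebras are real. *)

theory Defs
  imports "HOL-Analysis.Analysis" "HOL-Algebra.Generated_Groups"
begin

section \<open>Smooth maps between open subsets of Euclidean spaces\<close>

text \<open>The following notions are meant for open \<open>S\<close>.\<close>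

primrec Ck_on :: "nat \<Rightarrow> 'a::euclidean_space set \<Rightarrow> ('a \<Rightarrow> 'b::real_normed_vector) \<Rightarrow> bool" where
  "Ck_on 0 S f \<longleftrightarrow> continuous_on S f"
| "Ck_on (Suc n) S f \<longleftrightarrow>
     (\<forall>x\<in>S. f differentiable (at x)) \<and>
     (\<forall>v. Ck_on n S (\<lambda>x. frechet_derivative f (at x) v))"

definition smooth_on :: "'a::euclidean_space set \<Rightarrow> ('a \<Rightarrow> 'b::real_normed_vector) \<Rightarrow> bool" where
  "smooth_on S f \<longleftrightarrow> (\<forall>n. Ck_on n S f)"

text \<open>
  A continuous family of smooth maps \<open>f t\<close>: all derivatives of \<open>f t\<close> in the space variable
  exist and are continuous jointly in the parameter and the space variable. No
  differentiability in the parameter is required. The slices of \<open>D\<close> at fixed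
  parameter are meant to be open.
\<close>

primrec Ck_family_on ::
    "nat \<Rightarrow> ('t::topological_space \<times> 'a::euclidean_space) set \<Rightarrow>
     ('t \<Rightarrow> 'a \<Rightarrow> 'b::real_normed_vector) \<Rightarrow> bool" where
  "Ck_family_on 0 D f \<longleftrightarrow> continuous_on D (\<lambda>(t, x). f t x)"
| "Ck_family_on (Suc n) D f \<longleftrightarrow>
     (\<forall>(t, x)\<in>D. f t differentiable (at x)) \<and>
     (\<forall>v. Ck_family_on n D (\<lambda>t x. frechet_derivative (f t) (at x) v))"

definition smooth_family_on ::
    "('t::topological_space \<times> 'a::euclidean_space) set \<Rightarrow>
     ('t \<Rightarrow> 'a \<Rightarrow> 'b::real_normed_vector) \<Rightarrow> bool" where
  "smooth_family_on D f \<longleftrightarrow> (\<forall>n. Ck_family_on n D f)"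


section \<open>Smooth manifolds\<close>

text \<open>
  A chart is a pair of its domain and the coordinate map. The atlas need not be maximal.
  The dimension of a manifold (of type \<open>('p, 'e) manifold\<close>) is \<open>DIM('e)\<close>.
\<close>

type_synonym ('p, 'e) chart = "'p set \<times> ('p \<Rightarrow> 'e)"

record ('p, 'e) manifold =
  mtop :: "'p topology"
  atlas :: "('p, 'e) chart set"

abbreviation chart_inv :: "('p, 'e) chart \<Rightarrow> 'e \<Rightarrow> 'p" where
  "chart_inv c \<equiv> inv_into (fst c) (snd c)"

definition smooth_manifold :: "('p, 'e::euclidean_space) manifold \<Rightarrow> bool" where
  "smooth_manifold M \<longleftrightarrow>
     Hausdorff_space (mtop M) \<and> second_countable (mtop M) \<and>
     \<Union> (fst ` atlas M) = topspace (mtop M) \<and>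
     (\<forall>c\<in>atlas M. openin (mtop M) (fst c) \<and> open (snd c ` fst c) \<and>
        homeomorphic_map (subtopology (mtop M) (fst c)) (top_of_set (snd c ` fst c)) (snd c)) \<and>
     (\<forall>c\<in>atlas M. \<forall>d\<in>atlas M.
        smooth_on (snd c ` (fst c \<inter> fst d)) (snd d \<circ> chart_inv c))"

definition prod_manifold ::
    "('p, 'e) manifold \<Rightarrow> ('q, 'f) manifold \<Rightarrow> ('p \<times> 'q, 'e \<times> 'f) manifold" where
  "prod_manifold M N =
     \<lparr> mtop = prod_topology (mtop M) (mtop N),
       atlas = {(fst c \<times> fst d, map_prod (snd c) (snd d)) | c d. c \<in> atlas M \<and> d \<in> atlas N} \<rparr>"

definition smooth_map ::
    "('p, 'e::euclidean_space) manifold \<Rightarrow> ('q, 'f::euclidean_space) manifold \<Rightarrow> ('p \<Rightarrow> 'q) \<Rightarrow> bool"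
  where
  "smooth_map M N f \<longleftrightarrow>
     continuous_map (mtop M) (mtop N) f \<and>
     (\<forall>c\<in>atlas M. \<forall>d\<in>atlas N.
        smooth_on (snd c ` {x \<in> fst c. f x \<in> fst d}) (snd d \<circ> f \<circ> chart_inv c))"

definition smooth_map_family ::
    "'t::topological_space set \<Rightarrow> ('p, 'e::euclidean_space) manifold \<Rightarrow>
     ('q, 'f::euclidean_space) manifold \<Rightarrow> ('t \<Rightarrow> 'p \<Rightarrow> 'q) \<Rightarrow> bool" where
  "smooth_map_family T M N f \<longleftrightarrow>
     continuous_map (prod_topology (top_of_set T) (mtop M)) (mtop N) (\<lambda>(t, x). f t x) \<and>
     (\<forall>c\<in>atlas M. \<forall>d\<in>atlas N.
        smooth_family_on {(t, snd c x) | t x. t \<in> T \<and> x \<in> fst c \<and> f t x \<in> fst d}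
          (\<lambda>t. snd d \<circ> f t \<circ> chart_inv c))"

definition diffeomorphism ::
    "('p, 'e::euclidean_space) manifold \<Rightarrow> ('q, 'f::euclidean_space) manifold \<Rightarrow> ('p \<Rightarrow> 'q) \<Rightarrow> bool"
  where
  "diffeomorphism M N f \<longleftrightarrow>
     bij_betw f (topspace (mtop M)) (topspace (mtop N)) \<and>
     smooth_map M N f \<and> smooth_map N M (inv_into (topspace (mtop M)) f)"

definition simply_connected_space :: "'p topology \<Rightarrow> bool" where
  "simply_connected_space X \<longleftrightarrow>
     path_connected_space X \<and>
     (\<forall>p. pathin X p \<and> p 0 = p 1 \<longrightarrow>
        homotopic_with (\<lambda>h. h 0 = p 0 \<and> h 1 = p 0) (top_of_set {0..1}) X p (\<lambda>_. p 0))"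


section \<open>Nilpotent Lie groups\<close>

primrec lower_central_series :: "('a, 'b) monoid_scheme \<Rightarrow> nat \<Rightarrow> 'a set" where
  "lower_central_series G 0 = carrier G"
| "lower_central_series G (Suc n) =
     generate G {x \<otimes>\<^bsub>G\<^esub> y \<otimes>\<^bsub>G\<^esub> m_inv G x \<otimes>\<^bsub>G\<^esub> m_inv G y | x y.
                   x \<in> lower_central_series G n \<and> y \<in> carrier G}"

definition nilpotent_group :: "('a, 'b) monoid_scheme \<Rightarrow> bool" where
  "nilpotent_group G \<longleftrightarrow> group G \<and> (\<exists>n. lower_central_series G n = {\<one>\<^bsub>G\<^esub>})"

definition lie_group :: "('p, 'e::euclidean_space) manifold \<Rightarrow> 'p monoid \<Rightarrow> bool" where
  "lie_group M G \<longleftrightarrow>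
     smooth_manifold M \<and> group G \<and> carrier G = topspace (mtop M) \<and>
     smooth_map (prod_manifold M M) M (\<lambda>(x, y). x \<otimes>\<^bsub>G\<^esub> y) \<and>
     smooth_map M M (m_inv G)"

definition lie_isomorphic ::
    "('p, 'e::euclidean_space) manifold \<Rightarrow> 'p monoid \<Rightarrow>
     ('q, 'f::euclidean_space) manifold \<Rightarrow> 'q monoid \<Rightarrow> bool" where
  "lie_isomorphic M G N H \<longleftrightarrow> (\<exists>f\<in>iso G H. diffeomorphism M N f)"

text \<open>A continuous family of Lie group structures on one underlying manifold.\<close>

definition lie_group_family ::
    "'t::topological_space set \<Rightarrow> ('p, 'e::euclidean_space) manifold \<Rightarrow> ('t \<Rightarrow> 'p monoid) \<Rightarrow> bool"
  where
  "lie_group_family T M G \<longleftrightarrow>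
     (\<forall>t\<in>T. lie_group M (G t)) \<and>
     smooth_map_family T (prod_manifold M M) M (\<lambda>t (x, y). x \<otimes>\<^bsub>G t\<^esub> y) \<and>
     smooth_map_family T M M (\<lambda>t. m_inv (G t))"


section \<open>Riemannian metrics, isometries and geodesics\<close>

text \<open>
  \<open>g p c u v\<close> is the inner product of the tangent vectors at \<open>p\<close> whose coordinates in
  the chart \<open>c\<close> are \<open>u\<close> and \<open>v\<close>. It is meaningful only for \<open>c\<close> in the atlas and
  \<open>p \<in> fst c\<close>.
\<close>

type_synonym ('p, 'e) metric = "'p \<Rightarrow> ('p, 'e) chart \<Rightarrow> 'e \<Rightarrow> 'e \<Rightarrow> real"

text \<open>The differential of \<open>f\<close> at \<open>p\<close> in the charts \<open>c\<close> around \<open>p\<close> and \<open>d\<close> around \<open>f p\<close>.\<close>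

definition chart_deriv ::
    "('p, 'e::euclidean_space) chart \<Rightarrow> ('q, 'f::euclidean_space) chart \<Rightarrow>
     ('p \<Rightarrow> 'q) \<Rightarrow> 'p \<Rightarrow> 'e \<Rightarrow> 'f" where
  "chart_deriv c d f p = frechet_derivative (snd d \<circ> f \<circ> chart_inv c) (at (snd c p))"

definition preserves_metric ::
    "('p, 'e::euclidean_space) manifold \<Rightarrow> ('p, 'e) metric \<Rightarrow> ('p \<Rightarrow> 'p) \<Rightarrow> bool" where
  "preserves_metric M g f \<longleftrightarrow>
     (\<forall>c\<in>atlas M. \<forall>d\<in>atlas M. \<forall>p\<in>fst c. f p \<in> fst d \<longrightarrow>
        (\<forall>u v. g (f p) d (chart_deriv c d f p u) (chart_deriv c d f p v) = g p c u v))"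

text \<open>The conjunct for \<open>id\<close> says that \<open>g\<close> transforms as a tensor under changes of charts.\<close>

definition riemannian_metric ::
    "('p, 'e::euclidean_space) manifold \<Rightarrow> ('p, 'e) metric \<Rightarrow> bool" where
  "riemannian_metric M g \<longleftrightarrow>
     (\<forall>c\<in>atlas M. \<forall>p\<in>fst c.
        bilinear (g p c) \<and> (\<forall>u v. g p c u v = g p c v u) \<and> (\<forall>u. u \<noteq> 0 \<longrightarrow> g p c u u > 0)) \<and>
     (\<forall>c\<in>atlas M. \<forall>u v. smooth_on (snd c ` fst c) (\<lambda>x. g (chart_inv c x) c u v)) \<and>
     preserves_metric M g id"

definition metric_family ::
    "'s::topological_space set \<Rightarrow> ('p, 'e::euclidean_space) manifold \<Rightarrow>
     ('s \<Rightarrow> ('p, 'e) metric) \<Rightarrow> bool" where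
  "metric_family S M g \<longleftrightarrow>
     (\<forall>s\<in>S. riemannian_metric M (g s)) \<and>
     (\<forall>c\<in>atlas M. \<forall>u v.
        smooth_family_on (S \<times> snd c ` fst c) (\<lambda>s x. g s (chart_inv c x) c u v))"

definition same_metric ::
    "('p, 'e::euclidean_space) manifold \<Rightarrow> ('p, 'e) metric \<Rightarrow> ('p, 'e) metric \<Rightarrow> bool" where
  "same_metric M g h \<longleftrightarrow> (\<forall>c\<in>atlas M. \<forall>p\<in>fst c. g p c = h p c)"

definition isometry ::
    "('p, 'e::euclidean_space) manifold \<Rightarrow> ('p, 'e) metric \<Rightarrow> ('p \<Rightarrow> 'p) \<Rightarrow> bool" where
  "isometry M g f \<longleftrightarrow> diffeomorphism M M f \<and> preserves_metric M g f"

definition left_invariant ::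
    "('p, 'e::euclidean_space) manifold \<Rightarrow> 'p monoid \<Rightarrow> ('p, 'e) metric \<Rightarrow> bool" where
  "left_invariant M G g \<longleftrightarrow> (\<forall>a\<in>carrier G. isometry M g (\<lambda>x. a \<otimes>\<^bsub>G\<^esub> x))"

text \<open>
  The Christoffel symbols of the first kind, contracted with vectors:
  \<open>\<Gamma>(u,v,w) = (u(g(v,w)) + v(g(u,w)) - w(g(u,v))) / 2\<close> for constant \<open>u, v, w\<close> in the chart.
\<close>

definition christoffel ::
    "('p, 'e::euclidean_space) metric \<Rightarrow> ('p, 'e) chart \<Rightarrow> 'p \<Rightarrow> 'e \<Rightarrow> 'e \<Rightarrow> 'e \<Rightarrow> real" where
  "christoffel g c p u v w =
     (let D = (\<lambda>z a b. frechet_derivative (\<lambda>x. g (chart_inv c x) c a b) (at (snd c p)) z)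
      in (D u v w + D v u w - D w u v) / 2)"

text \<open>
  The geodesic equation of the Levi-Civita connection on an open interval \<open>I\<close>, with the index
  lowered by \<open>g\<close>: \<open>g(\<gamma>'', w) + \<Gamma>(\<gamma>', \<gamma>', w) = 0\<close> for all \<open>w\<close>. Here \<open>v\<close> and \<open>a\<close> are the first
  and second derivative of \<open>\<gamma>\<close> in coordinates.
\<close>

definition geodesic ::
    "('p, 'e::euclidean_space) manifold \<Rightarrow> ('p, 'e) metric \<Rightarrow> real set \<Rightarrow> (real \<Rightarrow> 'p) \<Rightarrow> bool"
  where
  "geodesic M g I \<gamma> \<longleftrightarrow>
     open I \<and> is_interval I \<and> I \<noteq> {} \<and>
     continuous_map (top_of_set I) (mtop M) \<gamma> \<and>
     (\<forall>c\<in>atlas M. \<exists>v a. \<forall>t\<in>I. \<gamma> t \<in> fst c \<longrightarrow>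
        ((snd c \<circ> \<gamma>) has_vector_derivative v t) (at t) \<and>
        (v has_vector_derivative a t) (at t) \<and>
        (\<forall>w. g (\<gamma> t) c (a t) w + christoffel g c (\<gamma> t) (v t) (v t) w = 0))"

text \<open>
  One-parameter subgroups of the full isometry group. Joint continuity is continuity of the
  homomorphism into the isometry group with the compact-open topology; \<open>\<phi> 0 = id\<close> on the
  manifold follows from the other conditions.
\<close>

definition one_parameter_isometry_group ::
    "('p, 'e::euclidean_space) manifold \<Rightarrow> ('p, 'e) metric \<Rightarrow> (real \<Rightarrow> 'p \<Rightarrow> 'p) \<Rightarrow> bool" where
  "one_parameter_isometry_group M g \<phi> \<longleftrightarrow>
     (\<forall>t. isometry M g (\<phi> t)) \<and>
     (\<forall>s t. \<forall>x\<in>topspace (mtop M). \<phi> (s + t) x = \<phi> s (\<phi> t x)) \<and>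
     continuous_map (prod_topology euclideanreal (mtop M)) (mtop M) (\<lambda>(t, x). \<phi> t x)"

text \<open>
  Geodesics on all open intervals are considered. Since an orbit \<open>\<lambda>t. \<phi> t p\<close> that agrees
  with a geodesic on an interval is a geodesic on the whole line, this says that the metric is
  complete and that the maximal geodesics are exactly parametrised by such orbits.
\<close>

definition geodesic_orbit ::
    "('p, 'e::euclidean_space) manifold \<Rightarrow> ('p, 'e) metric \<Rightarrow> bool" where
  "geodesic_orbit M g \<longleftrightarrow>
     riemannian_metric M g \<and>
     (\<forall>I \<gamma>. geodesic M g I \<gamma> \<longrightarrow>
        (\<exists>\<phi> p. one_parameter_isometry_group M g \<phi> \<and> p \<in> topspace (mtop M) \<and>
           (\<forall>t\<in>I. \<gamma> t = \<phi> t p)))"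

end

theory Submission
  imports Defs
begin

text \<open>
  The groups are 2-step nilpotent with Lie algebra \<open>v \<oplus> z\<close>, where \<open>z\<close> is a plane, \<open>v\<close> is a sum of
  \<open>2k + 2\<close> planes \<open>C\<^sub>j\<close> with area forms \<open>\<omega>\<^sub>j\<close>, and \<open>[x, y] = \<Sum>\<^sub>j \<omega>\<^sub>j(x\<^sub>j, y\<^sub>j) \<lambda>\<^sub>j\<close> with \<open>\<lambda>\<^sub>j \<in> z\<close>.
  For an inner product that is diagonal on these summands, the operators \<open>J\<^sub>Z\<close> commute: each one
  rotates every \<open>C\<^sub>j\<close>. Hence \<open>J\<^sub>Z\<close> is itself a skew-symmetric derivation that kills \<open>z\<close>, and after a left
  translation every geodesic is \<open>t \<mapsto> exp(tY) R\<^sub>t b\<close>, where \<open>R\<^sub>t\<close> is a one-parameter group of isometric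
  automorphisms fixing \<open>Y\<close>. The three parameters of the metric are the two weights on \<open>z\<close> and the
  weight on \<open>v\<close>.

  A Lie group isomorphism is linear in the exponential chart, and it maps the radical of each form
  \<open>\<xi> \<circ> [\<cdot>, \<cdot>]\<close>, \<open>\<xi> \<in> z*\<close>, to such a radical. So it maps the lines \<open>\<real>\<lambda>\<^sub>j\<close> to one another with their
  multiplicities. Four lines \<open>\<infinity>, 0, 1, x\<^sub>0\<close> of multiplicity one, with \<open>x\<^sub>0 > 2\<close>, have a cross ratio that
  determines \<open>x\<^sub>0\<close>; lines \<open>x\<^sub>1 < \<dots> < x\<^sub>k\<^sub>-\<^sub>1\<close> of multiplicity two in \<open>(0, 1/2)\<close> are then fixed as well,
  since the Klein four-group, which preserves the cross ratio, moves them out of that interval.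
\<close>

section \<open>Smooth families on Euclidean space\<close>

text \<open>Whole functions agree for each parameter in \<open>T\<close>, hence so do their
  derivatives. This allows a derivative to be replaced by a formula that is known only for
  parameters in \<open>T\<close>.\<close>

lemma Ck_family_on_cong:
  assumes "\<And>t. t \<in> T \<Longrightarrow> f t = g t"
  shows "Ck_family_on n (T \<times> UNIV) f \<longleftrightarrow> Ck_family_on n (T \<times> UNIV) g"
  using assms
proof (induction n arbitrary: f g)
  case 0
  then show ?case by (auto intro!: continuous_on_cong)
next
  case (Suc n)
  have "Ck_family_on n (T \<times> UNIV) (\<lambda>t x. frechet_derivative (f t) (at x) v)
      \<longleftrightarrow> Ck_family_on n (T \<times> UNIV) (\<lambda>t x. frechet_derivative (g t) (at x) v)" for v
    by (rule Suc.IH) (simp add: Suc.prems)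
  then show ?case using Suc.prems by auto
qed

lemma Ck_family_on_imp_Ck_on:
  "Ck_family_on n D f \<Longrightarrow> Ck_on n {x. (t, x) \<in> D} (f t)"
proof (induction n arbitrary: f)
  case 0
  then have "continuous_on D (\<lambda>(t, x). f t x)" by simp
  then have "continuous_on {x. (t, x) \<in> D} ((\<lambda>(t, x). f t x) \<circ> Pair t)"
    by (intro continuous_on_compose continuous_intros) (auto elim: continuous_on_subset)
  then show ?case by (simp add: o_def)
next
  case (Suc n)
  then show ?case by auto
qed

lemma smooth_family_on_imp_smooth_on:
  "smooth_family_on (T \<times> UNIV) f \<Longrightarrow> t \<in> T \<Longrightarrow> smooth_on UNIV (f t)"
  using Ck_family_on_imp_Ck_on[where D = "T \<times> UNIV" and t = t and f = f]
  by (simp add: smooth_family_on_def smooth_on_def)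

lemma smooth_family_onD:
  assumes "smooth_family_on (T \<times> UNIV) f"
  shows "t \<in> T \<Longrightarrow> f t differentiable (at x)"
    and "smooth_family_on (T \<times> UNIV) (\<lambda>t x. frechet_derivative (f t) (at x) v)"
    and "Ck_family_on n (T \<times> UNIV) f"
proof -
  have c: "Ck_family_on m (T \<times> UNIV) f" for m
    using assms by (simp add: smooth_family_on_def)
  show "f t differentiable (at x)" if "t \<in> T"
    using c[of "Suc 0"] that by auto
  show "smooth_family_on (T \<times> UNIV) (\<lambda>t x. frechet_derivative (f t) (at x) v)"
    unfolding smooth_family_on_def
  proof
    show "Ck_family_on m (T \<times> UNIV) (\<lambda>t x. frechet_derivative (f t) (at x) v)" for m
      using c[of "Suc m"] by simp
  qed
  show "Ck_family_on n (T \<times> UNIV) f" by (rule c)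
qed

lemma smooth_family_on_const:
  fixes T :: "'t::topological_space set" and h :: "'t \<Rightarrow> 'b::real_normed_vector"
  assumes "continuous_on T h"
  shows "smooth_family_on (T \<times> (UNIV :: 'a::euclidean_space set)) (\<lambda>t x. h t)"
proof -
  have "Ck_family_on n (T \<times> (UNIV :: 'a set)) (\<lambda>t x. h t)" for n
    using assms
  proof (induction n arbitrary: h)
    case 0
    then show ?case
      by (auto simp: case_prod_beta intro!: continuous_intros continuous_on_compose2[of T h _ fst])
  next
    case (Suc n)
    show ?case using Suc.IH[of "\<lambda>_. 0"] by auto
  qed
  then show ?thesis by (simp add: smooth_family_on_def)
qed

lemma smooth_family_on_linear:
  fixes P :: "'a::euclidean_space \<Rightarrow> 'b::real_normed_vector"
  assumes "bounded_linear P"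
  shows "smooth_family_on (T \<times> UNIV) (\<lambda>t. P)"
  unfolding smooth_family_on_def
proof
  have d: "frechet_derivative P (at x) = P" for x
    by (rule frechet_derivative_at[symmetric]) (rule bounded_linear_imp_has_derivative[OF assms])
  fix n
  show "Ck_family_on n (T \<times> UNIV) (\<lambda>t. P)"
  proof (cases n)
    case 0
    then show ?thesis
      by (auto simp: case_prod_beta intro!: bounded_linear.continuous_on[OF assms] continuous_intros)
  next
    case (Suc m)
    then show ?thesis
      using assms smooth_family_on_const[of T "\<lambda>_. P _"]
      by (auto simp: d smooth_family_on_def intro: bounded_linear_imp_differentiable)
  qed
qed

lemma Ck_family_on_add:
  assumes "Ck_family_on n (T \<times> UNIV) f" "Ck_family_on n (T \<times> UNIV) g"
  shows "Ck_family_on n (T \<times> UNIV) (\<lambda>t x. f t x + g t x)"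
  using assms
proof (induction n arbitrary: f g)
  case 0
  then show ?case by (auto simp: case_prod_beta intro: continuous_intros)
next
  case (Suc n)
  have d: "f t differentiable (at x)" "g t differentiable (at x)" if "t \<in> T" for t x
    using Suc.prems that by auto
  have d': "frechet_derivative (\<lambda>x. f t x + g t x) (at x)
      = (\<lambda>v. frechet_derivative (f t) (at x) v + frechet_derivative (g t) (at x) v)"
    if "t \<in> T" for t x
    using d[OF that] unfolding frechet_derivative_works
    by (intro frechet_derivative_at[symmetric] has_derivative_add)
  have "Ck_family_on n (T \<times> UNIV) (\<lambda>t x. frechet_derivative (\<lambda>x. f t x + g t x) (at x) v)" for v
  proof (subst Ck_family_on_cong)
    show "Ck_family_on n (T \<times> UNIV)
       (\<lambda>t x. frechet_derivative (f t) (at x) v + frechet_derivative (g t) (at x) v)"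
      by (rule Suc.IH) (use Suc.prems in auto)
  qed (auto simp: d')
  then show ?case using d by (auto intro: differentiable_add)
qed

lemma smooth_family_on_add:
  assumes "smooth_family_on (T \<times> UNIV) f" "smooth_family_on (T \<times> UNIV) g"
  shows "smooth_family_on (T \<times> UNIV) (\<lambda>t x. f t x + g t x)"
  using assms unfolding smooth_family_on_def by (intro allI Ck_family_on_add) auto

lemma smooth_family_on_sum:
  assumes "\<And>i. i \<in> A \<Longrightarrow> smooth_family_on (T \<times> UNIV) (f i)"
  shows "smooth_family_on (T \<times> UNIV) (\<lambda>t x. \<Sum>i\<in>A. f i t x)"
  using assms
  by (induction A rule: infinite_finite_induct)
     (auto intro: smooth_family_on_add smooth_family_on_const[of _ "\<lambda>_. 0"])

text \<open>The product rule pairs a derivative with an undifferentiated factor. With full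
  smoothness assumed of both factors, the induction on the order applies to each such pair.\<close>

lemma smooth_family_on_bilinear:
  assumes "bounded_bilinear pr"
    and "smooth_family_on (T \<times> UNIV) f" "smooth_family_on (T \<times> UNIV) g"
  shows "smooth_family_on (T \<times> UNIV) (\<lambda>t x. pr (f t x) (g t x))"
proof -
  interpret bounded_bilinear pr by fact
  have "Ck_family_on n (T \<times> UNIV) (\<lambda>t x. pr (f t x) (g t x))" for n
    using assms(2,3)
  proof (induction n arbitrary: f g)
    case 0
    then have "Ck_family_on 0 (T \<times> UNIV) f" "Ck_family_on 0 (T \<times> UNIV) g"
      by (auto simp only: smooth_family_on_def)
    then show ?case by (auto simp: case_prod_beta intro: continuous_on)
  next
    case (Suc n)
    have d: "((\<lambda>x. pr (f t x) (g t x)) has_derivative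
        (\<lambda>v. pr (f t x) (frechet_derivative (g t) (at x) v)
           + pr (frechet_derivative (f t) (at x) v) (g t x))) (at x)" if "t \<in> T" for t x
      using smooth_family_onD(1)[OF Suc.prems(1) that] smooth_family_onD(1)[OF Suc.prems(2) that]
      by (intro FDERIV) (auto simp: frechet_derivative_works)
    have "Ck_family_on n (T \<times> UNIV)
            (\<lambda>t x. frechet_derivative (\<lambda>x. pr (f t x) (g t x)) (at x) v)" for v
    proof (subst Ck_family_on_cong)
      show "Ck_family_on n (T \<times> UNIV)
         (\<lambda>t x. pr (f t x) (frechet_derivative (g t) (at x) v)
           + pr (frechet_derivative (f t) (at x) v) (g t x))"
        by (intro Ck_family_on_add Suc.IH Suc.prems smooth_family_onD(2))
    qed (auto simp: frechet_derivative_at[OF d, symmetric])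
    then show ?case using d by (auto simp: differentiable_def)
  qed
  then show ?thesis by (simp add: smooth_family_on_def)
qed

lemmas smooth_family_on_mult = smooth_family_on_bilinear[OF bounded_bilinear_mult]
lemmas smooth_family_on_scaleR = smooth_family_on_bilinear[OF bounded_bilinear_scaleR]

lemma smooth_family_on_cong:
  assumes "\<And>t. t \<in> T \<Longrightarrow> f t = g t"
  shows "smooth_family_on (T \<times> UNIV) f \<longleftrightarrow> smooth_family_on (T \<times> UNIV) g"
proof -
  have "Ck_family_on n (T \<times> UNIV) f \<longleftrightarrow> Ck_family_on n (T \<times> UNIV) g" for n
    by (rule Ck_family_on_cong) (rule assms)
  then show ?thesis by (simp only: smooth_family_on_def)
qed

lemma smooth_family_on_compose_linear:
  assumes "bounded_linear P" "smooth_family_on (T \<times> UNIV) f"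
  shows "smooth_family_on (T \<times> UNIV) (\<lambda>t x. P (f t x))"
proof -
  \<comment> \<open>The map is written as the bilinear expression \<open>r *\<^sub>R P z\<close>
    with the constant family \<open>r = 1\<close>.\<close>
  have "smooth_family_on (T \<times> UNIV) (\<lambda>t x. 1 *\<^sub>R P (f t x))"
    by (rule smooth_family_on_bilinear[OF
          bounded_bilinear.comp[OF bounded_bilinear_scaleR bounded_linear_ident assms(1)] _ assms(2)])
       (rule smooth_family_on_const, simp)
  then show ?thesis by simp
qed

lemma smooth_on_affine:
  fixes L :: "'a::euclidean_space \<Rightarrow> 'b::euclidean_space"
  assumes "linear L"
  shows "smooth_on UNIV (\<lambda>x. a + L x)"
proof -
  \<comment> \<open>The parameter space is a dummy: a constant family carries the results on
    families over to single maps.\<close>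
  have "smooth_family_on ((UNIV :: real set) \<times> UNIV) (\<lambda>t x. a + L x)"
    using assms by (intro smooth_family_on_add smooth_family_on_const smooth_family_on_linear)
      (auto simp: linear_conv_bounded_linear)
  then show ?thesis using smooth_family_on_imp_smooth_on by blast
qed

section \<open>Euclidean space as a manifold with one global chart\<close>

definition chart_space :: "('a::euclidean_space, 'a) manifold" where
  "chart_space = \<lparr>mtop = euclidean, atlas = {(UNIV, id)}\<rparr>"

lemma chart_space_simps [simp]:
  "mtop chart_space = euclidean" "atlas chart_space = {(UNIV, id)}"
  by (simp_all add: chart_space_def)

lemma prod_chart_space [simp]: "prod_manifold chart_space chart_space = chart_space"
  by (simp add: prod_manifold_def euclidean_product_topology)
     (auto simp: chart_space_def)

lemma smooth_manifold_chart_space: "smooth_manifold chart_space"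
proof -
  have "second_countable (euclidean :: 'a topology)"
  proof -
    obtain B :: "'a set set" where "countable B" "topological_basis B"
      using ex_countable_basis by blast
    then show ?thesis
      unfolding second_countable_def by (metis open_openin topological_basis_def topological_basisE)
  qed
  moreover have "homeomorphic_map (euclidean :: 'a topology) euclidean id"
    by simp
  moreover have "smooth_on UNIV (id :: 'a \<Rightarrow> 'a)"
    using smooth_on_affine[OF linear_id, of 0] by (simp add: id_def)
  ultimately show ?thesis
    by (simp add: smooth_manifold_def)
qed

lemma smooth_map_chart_space:
  "smooth_map chart_space chart_space f \<longleftrightarrow> smooth_on UNIV f"
proof -
  have "smooth_on UNIV f \<Longrightarrow> continuous_on UNIV f"
    unfolding smooth_on_def by (metis Ck_on.simps(1))
  then show ?thesis by (auto simp: smooth_map_def)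
qed

lemma smooth_map_family_chart_space:
  fixes f :: "'t::topological_space \<Rightarrow> 'a::euclidean_space \<Rightarrow> 'b::euclidean_space"
  assumes "smooth_family_on (T \<times> UNIV) f"
  shows "smooth_map_family T chart_space chart_space f"
proof -
  have "continuous_on (T \<times> UNIV) (\<lambda>(t, x). f t x)"
    using smooth_family_onD(3)[OF assms, of 0] by simp
  moreover have "prod_topology (top_of_set T) euclidean = top_of_set (T \<times> (UNIV :: 'a set))"
    using subtopology_Times[of euclidean euclidean T "UNIV :: 'a set"]
    by (simp add: euclidean_product_topology)
  moreover have "{(t, x) | t x. t \<in> T} = T \<times> (UNIV :: 'a set)" by auto
  ultimately show ?thesis using assms by (simp add: smooth_map_family_def)
qed

lemma simply_connected_euclidean:
  "simply_connected_space (euclidean :: 'a::euclidean_space topology)"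
  unfolding simply_connected_space_def
proof (intro conjI allI impI)
  show "path_connected_space (euclidean :: 'a topology)"
    using path_connectedin_topspace[of "euclidean :: 'a topology"] by simp
  fix p :: "real \<Rightarrow> 'a"
  assume p: "pathin euclidean p \<and> p 0 = p 1"
  then have c: "continuous_on {0..1} p" by (simp add: pathin_def)
  show "homotopic_with (\<lambda>h. h 0 = p 0 \<and> h 1 = p 0) (top_of_set {0..1}) euclidean p (\<lambda>_. p 0)"
    unfolding homotopic_with_def
  proof (intro exI conjI ballI allI)
    \<comment> \<open>Straight-line contraction of the loop to its base point; it fixes both
      endpoints because they equal \<open>p 0\<close>.\<close>
    show "continuous_map (prod_topology (top_of_set {0..1}) (top_of_set {0..1})) euclidean
       (\<lambda>z. p (snd z) + fst z *\<^sub>R (p 0 - p (snd z)))"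
      by (auto simp flip: subtopology_Times simp: euclidean_product_topology
          intro!: continuous_intros continuous_on_compose2[OF c])
  qed (use p in auto)
qed

section \<open>Two-step nilpotent groups with two-dimensional center\<close>

text \<open>
  \<open>z1, z2\<close> are the coordinates of \<open>z\<close>; \<open>\<tau>\<close> exchanges the two coordinates of each plane \<open>C\<^sub>j\<close>, and \<open>\<epsilon>\<close> is
  \<open>1\<close> on one of them and \<open>-1\<close> on the other.
\<close>

locale plane_frame =
  fixes z1 z2 :: "'n::finite" and \<tau> :: "'n \<Rightarrow> 'n" and \<epsilon> :: "'n \<Rightarrow> real"
  assumes z_distinct: "z1 \<noteq> z2"
    and tau_tau [simp]: "\<tau> (\<tau> i) = i"
    and eps_tau [simp]: "\<epsilon> (\<tau> i) = - \<epsilon> i"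
    and eps_square: "i \<noteq> z1 \<Longrightarrow> i \<noteq> z2 \<Longrightarrow> \<epsilon> i * \<epsilon> i = 1"
    and eps_z [simp]: "\<epsilon> z1 = 0" "\<epsilon> z2 = 0"
begin

lemma eps_eq_0_iff: "\<epsilon> i = 0 \<longleftrightarrow> i = z1 \<or> i = z2"
  using eps_square[of i] by (cases "i = z1 \<or> i = z2") auto

lemma sum_tau: "(\<Sum>i\<in>UNIV. f (\<tau> i)) = (\<Sum>i\<in>UNIV. f i)"
  by (rule sum.reindex_bij_witness[of _ \<tau> \<tau>]) auto

text \<open>Quarter turn in every plane, since \<open>\<epsilon>\<close> has opposite signs on its
  two coordinates, and zero on z.\<close>

definition J :: "real^'n \<Rightarrow> real^'n" where
  "J x = (\<chi> i. \<epsilon> i * x $ \<tau> i)"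

text \<open>For \<open>c\<close> constant on the planes, this is the linear combination of their
  area forms with coefficients \<open>c\<close>.\<close>

definition form :: "('n \<Rightarrow> real) \<Rightarrow> real^'n \<Rightarrow> real^'n \<Rightarrow> real" where
  "form c x y = (\<Sum>i\<in>UNIV. c i * (J x $ i) * (y $ i))"

lemma J_nth [simp]: "J x $ i = \<epsilon> i * x $ \<tau> i"
  by (simp add: J_def)

lemma J_J_nth: "\<epsilon> i \<noteq> 0 \<Longrightarrow> \<epsilon> i * (\<epsilon> i * x) = x"
  using eps_square[of i] by (metis eps_z mult.assoc mult_1)

lemma form_add_left: "form c (x + x') y = form c x y + form c x' y"
  and form_add_right: "form c x (y + y') = form c x y + form c x y'"
  and form_scaleR_left: "form c (r *\<^sub>R x) y = r * form c x y"
  and form_scaleR_right: "form c x (r *\<^sub>R y) = r * form c x y"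
  by (simp_all add: form_def algebra_simps sum.distrib sum_distrib_left)

text \<open>Reindexing by \<open>\<tau>\<close> exchanges the roles of \<open>x\<close> and
  \<open>y\<close> in each summand and reverses the sign \<open>\<epsilon>\<close>.\<close>

lemma form_skew:
  assumes "\<And>i. c (\<tau> i) = c i"
  shows "form c x y = - form c y x"
proof -
  have "form c x y = (\<Sum>i\<in>UNIV. c (\<tau> i) * (J x $ \<tau> i) * (y $ \<tau> i))"
    unfolding form_def by (rule sum_tau[symmetric])
  also have "\<dots> = - form c y x"
    by (simp add: form_def assms sum_negf mult_ac)
  finally show ?thesis .
qed

lemma form_axis: "form c x (axis i 1) = c i * (J x $ i)"
  by (simp add: form_def axis_def if_distrib[of "\<lambda>r. _ * r"] cong: if_cong)

lemma form_cong:
  assumes "\<And>i. c i \<noteq> 0 \<Longrightarrow> \<epsilon> i \<noteq> 0 \<Longrightarrow> x $ \<tau> i = x' $ \<tau> i \<and> y $ i = y' $ i"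
  shows "form c x y = form c x' y'"
  unfolding form_def
proof (rule sum.cong)
  show "c i * J x $ i * y $ i = c i * J x' $ i * y' $ i" for i
    using assms[of i] by (cases "c i = 0 \<or> \<epsilon> i = 0") auto
qed simp

lemma form_eq_0:
  assumes "\<And>i. c i \<noteq> 0 \<Longrightarrow> \<epsilon> i \<noteq> 0 \<Longrightarrow> x $ \<tau> i = 0 \<or> y $ i = 0"
  shows "form c x y = 0"
  unfolding form_def by (rule sum.neutral) (use assms in auto)

text \<open>Rotation of each plane through the angle \<open>\<mu> i * t\<close>. It is used for
  \<open>\<mu>\<close> constant on planes and zero on z; then it is the exponential of
  \<open>t\<close> times the skew operator \<open>\<mu> J\<close> and fixes z.\<close>

definition rot :: "('n \<Rightarrow> real) \<Rightarrow> real \<Rightarrow> real^'n \<Rightarrow> real^'n" where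
  "rot \<mu> t x = (\<chi> i. cos (\<mu> i * t) * x $ i + sin (\<mu> i * t) * J x $ i)"

end

text \<open>\<open>c1 i\<close> and \<open>c2 i\<close> are the coordinates of the vector in z
  attached to the plane of \<open>i\<close>. The bracket composed with a functional on z is a member
  of the pencil spanned by \<open>form c1\<close> and \<open>form c2\<close>.\<close>

locale pencil = plane_frame z1 z2 \<tau> \<epsilon>
  for z1 z2 :: "'n::finite" and \<tau> \<epsilon> +
  fixes c1 c2 :: "'n \<Rightarrow> real"
  assumes c_tau [simp]: "c1 (\<tau> i) = c1 i" "c2 (\<tau> i) = c2 i"
    and c_central: "\<epsilon> i = 0 \<Longrightarrow> c1 i = 0" "\<epsilon> i = 0 \<Longrightarrow> c2 i = 0"
begin

definition br :: "real^'n \<Rightarrow> real^'n \<Rightarrow> real^'n" where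
  "br x y = form c1 x y *\<^sub>R axis z1 1 + form c2 x y *\<^sub>R axis z2 1"

text \<open>The Baker-Campbell-Hausdorff product, which stops here because brackets are central. The
  group is thus written in exponential coordinates.\<close>

definition mul :: "real^'n \<Rightarrow> real^'n \<Rightarrow> real^'n" where
  "mul x y = x + y + (1/2) *\<^sub>R br x y"

definition grp :: "(real^'n) monoid" where
  "grp = \<lparr>carrier = UNIV, monoid.mult = mul, one = 0\<rparr>"

lemma bilinear_br: "bilinear br"
  unfolding bilinear_def
  by (auto intro!: linearI simp: br_def form_add_left form_add_right form_scaleR_left
      form_scaleR_right algebra_simps)

lemma bounded_bilinear_br: "bounded_bilinear br"
  using bilinear_br bilinear_conv_bounded_bilinear by blast

lemmas br_simps = bilinear_ladd[OF bilinear_br] bilinear_radd[OF bilinear_br]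
  bilinear_lmul[OF bilinear_br] bilinear_rmul[OF bilinear_br] bilinear_lneg[OF bilinear_br]
  bilinear_rneg[OF bilinear_br] bilinear_lzero[OF bilinear_br] bilinear_rzero[OF bilinear_br]
  bilinear_lsub[OF bilinear_br] bilinear_rsub[OF bilinear_br]

lemma br_nth: "br x y $ i = (if i = z1 then form c1 x y else if i = z2 then form c2 x y else 0)"
  using z_distinct by (auto simp: br_def axis_def)

lemma br_skew: "br x y = - br y x"
  unfolding br_def by (subst (1 2) form_skew) auto

lemma br_self [simp]: "br x x = 0"
  using br_skew[of x x] by (simp add: vec_eq_iff)

text \<open>Brackets lie in z, while \<open>form\<close> reads only coordinates at which
  \<open>\<epsilon>\<close> is nonzero.\<close>

lemma br_br_left [simp]: "br (br x y) z = 0"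
proof -
  have "form c (br x y) z = form c 0 z" for c
    by (rule form_cong) (metis br_nth eps_z eps_tau neg_equal_0_iff_equal zero_index)
  then show ?thesis by (simp add: br_def form_def)
qed

lemma br_br_right [simp]: "br z (br x y) = 0"
  using br_skew[of z "br x y"] by simp

lemma mul_assoc: "mul (mul x y) z = mul x (mul y z)"
  by (simp add: mul_def br_simps algebra_simps)

lemma mul_simps [simp]: "mul 0 x = x" "mul x 0 = x" "mul (- x) x = 0" "mul x (- x) = 0"
  by (simp_all add: mul_def br_simps)

lemma mul_cancel [simp]: "mul (- x) (mul x y) = y" "mul x (mul (- x) y) = y"
  by (simp_all flip: mul_assoc)

lemma grp_simps [simp]: "carrier grp = UNIV" "x \<otimes>\<^bsub>grp\<^esub> y = mul x y" "\<one>\<^bsub>grp\<^esub> = 0"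
  by (simp_all add: grp_def)

lemma group_grp: "group grp"
proof (rule groupI)
  show "\<exists>y\<in>carrier grp. y \<otimes>\<^bsub>grp\<^esub> x = \<one>\<^bsub>grp\<^esub>" for x
    by (intro bexI[of _ "- x"]) simp_all
qed (simp_all add: mul_assoc)

lemma inv_grp [simp]: "m_inv grp x = - x"
  by (rule group.inv_equality[OF group_grp]) simp_all

lemma commutator_mul: "mul (mul (mul x y) (- x)) (- y) = br x y"
  using br_skew[of y x] by (simp add: mul_def br_simps algebra_simps)

text \<open>Group commutators equal brackets, so the first commutator subgroup lies in the center
  \<open>?Z\<close>, and all generators of the second are trivial.\<close>

lemma nilpotent_grp: "nilpotent_group grp"
proof -
  let ?Z = "{z. \<forall>x. br z x = 0}"
  have sub: "subgroup ?Z grp"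
    by (rule group.subgroupI[OF group_grp]) (auto simp: mul_def br_simps intro: exI[where x = 0])
  have "lower_central_series grp 1 \<subseteq> ?Z"
    by (auto simp: commutator_mul
       dest!: subsetD[OF group.generate_subgroup_incl[OF group_grp _ sub], rotated])
  then have "{mul (mul (mul x y) (- x)) (- y) | x y. x \<in> lower_central_series grp 1} \<subseteq> {0}"
    by (auto simp: commutator_mul)
  then have "lower_central_series grp 2 \<subseteq> generate grp {0}"
    unfolding numeral_2_eq_2 lower_central_series.simps(2)[of _ "Suc 0"]
    by (intro group.mono_generate[OF group_grp]) simp
  also have "generate grp {0} = {0}"
    using group.generate_one[OF group_grp] by simp
  finally have "lower_central_series grp 2 \<subseteq> {0}" .
  moreover have "0 \<in> lower_central_series grp 2"
    using generate.one[of grp] by (simp add: numeral_2_eq_2)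
  ultimately have "lower_central_series grp 2 = {\<one>\<^bsub>grp\<^esub>}" by auto
  then show ?thesis unfolding nilpotent_group_def using group_grp by blast
qed

end

section \<open>Left-invariant metrics\<close>

text \<open>Left translations and rotations are affine in the exponential chart, so their
  differentials are their linear parts. Including an affine inverse gives a class closed under
  composition whose members are diffeomorphisms.\<close>

definition affine_isometry :: "('e::euclidean_space \<Rightarrow> 'e \<Rightarrow> 'e \<Rightarrow> real) \<Rightarrow> ('e \<Rightarrow> 'e) \<Rightarrow> bool" where
  "affine_isometry g f \<longleftrightarrow> (\<exists>a L a' L'. linear L \<and> linear L' \<and> (\<forall>x. f x = a + L x) \<and>
     (\<forall>x. f (a' + L' x) = x) \<and> (\<forall>x. a' + L' (f x) = x) \<and>
     (\<forall>p u v. g (f p) (L u) (L v) = g p u v))"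

lemma affine_isometryI:
  assumes "linear L" "linear L'" "\<And>x. f x = a + L x" "\<And>x. f (a' + L' x) = x"
    "\<And>x. a' + L' (f x) = x" "\<And>p u v. g (f p) (L u) (L v) = g p u v"
  shows "affine_isometry g f"
  unfolding affine_isometry_def using assms by blast

lemma affine_isometry_comp:
  assumes "affine_isometry g f" "affine_isometry g h"
  shows "affine_isometry g (\<lambda>x. f (h x))"
proof -
  obtain a L a' L' where f: "linear L" "linear L'" "\<And>x. f x = a + L x" "\<And>x. f (a' + L' x) = x"
    "\<And>x. a' + L' (f x) = x" "\<And>p u v. g (f p) (L u) (L v) = g p u v"
    using assms(1) unfolding affine_isometry_def by blast
  obtain b M b' M' where h: "linear M" "linear M'" "\<And>x. h x = b + M x" "\<And>x. h (b' + M' x) = x"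
    "\<And>x. b' + M' (h x) = x" "\<And>p u v. g (h p) (M u) (M v) = g p u v"
    using assms(2) unfolding affine_isometry_def by blast
  show ?thesis
  proof (rule affine_isometryI)
    show "linear (\<lambda>x. L (M x))" "linear (\<lambda>x. M' (L' x))"
      using linear_compose[OF h(1) f(1)] linear_compose[OF f(2) h(2)] by (simp_all add: o_def)
    show "f (h x) = (a + L b) + L (M x)" for x
      using h(3)[of x] f(3)[of "h x"] linear_add[OF f(1)] by (simp add: add.assoc)
    have inv: "(b' + M' a') + M' (L' x) = b' + M' (a' + L' x)" for x
      using linear_add[OF h(2)] by (simp add: add.assoc)
    show "f (h ((b' + M' a') + M' (L' x))) = x" for x
      unfolding inv h(4) f(4) ..
    show "(b' + M' a') + M' (L' (f (h x))) = x" for x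
      unfolding inv f(5) h(5) ..
    show "g (f (h p)) (L (M u)) (L (M v)) = g p u v" for p u v
      by (simp only: f(6) h(6))
  qed
qed

lemma frechet_derivative_affine:
  fixes L :: "'a::euclidean_space \<Rightarrow> 'b::euclidean_space"
  assumes "linear L" "\<And>x. f x = a + L x"
  shows "frechet_derivative f (at p) = L"
proof -
  have "f = (\<lambda>x. a + L x)" using assms(2) by blast
  moreover have "((\<lambda>x. a + L x) has_derivative (\<lambda>x. 0 + L x)) (at p)"
    using assms(1) by (intro has_derivative_add has_derivative_const linear_imp_has_derivative)
  ultimately show ?thesis by (simp add: frechet_derivative_at[symmetric])
qed

lemma preserves_metric_affine:
  assumes "linear L" "\<And>x. f x = a + L x" "\<And>p u v. g (f p) (L u) (L v) = g p u v"
  shows "preserves_metric chart_space (\<lambda>p c. g p) f"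
  using assms(3) by (simp add: preserves_metric_def chart_deriv_def frechet_derivative_affine[OF assms(1,2)])

lemma affine_isometry_imp_isometry:
  assumes "affine_isometry g f"
  shows "isometry chart_space (\<lambda>p c. g p) f"
proof -
  obtain a L a' L' where f: "linear L" "linear L'" "\<And>x. f x = a + L x" "\<And>x. f (a' + L' x) = x"
    "\<And>x. a' + L' (f x) = x" "\<And>p u v. g (f p) (L u) (L v) = g p u v"
    using assms unfolding affine_isometry_def by blast
  have inv: "inv_into UNIV f = (\<lambda>x. a' + L' x)"
    by (rule inv_equality) (simp_all add: f(4,5))
  have "bij f" using f(4,5) by (intro o_bij[of "\<lambda>x. a' + L' x"]) auto
  moreover have "smooth_on UNIV f"
    using smooth_on_affine[OF f(1), of a] by (simp add: f(3) [symmetric])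
  ultimately show ?thesis
    using preserves_metric_affine[where g = g and f = f and L = L and a = a, OF f(1,3,6)]
      smooth_on_affine[OF f(2), of a']
    by (simp add: isometry_def diffeomorphism_def smooth_map_chart_space inv)
qed

context pencil
begin

text \<open>\<open>theta p\<close> is the differential at \<open>p\<close> of the left translation by the inverse of \<open>p\<close>.\<close>

definition theta :: "real^'n \<Rightarrow> real^'n \<Rightarrow> real^'n" where
  "theta p u = u - (1/2) *\<^sub>R br p u"

lemma linear_theta: "linear (theta p)"
  by (rule linearI) (auto simp: theta_def br_simps algebra_simps)

text \<open>A vector killed by \<open>theta p\<close> is a multiple of a bracket, hence central, so
  its bracket with \<open>p\<close> vanishes as well.\<close>

lemma theta_eq_0: "theta p u = 0 \<Longrightarrow> u = 0"
proof -
  assume "theta p u = 0"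
  then have u: "u = (1/2) *\<^sub>R br p u" by (simp add: theta_def)
  have "br p u = (1/2) *\<^sub>R br p (br p u)" by (subst u) (simp only: br_simps)
  then have "br p u = 0" by simp
  then show "u = 0" using u by simp
qed

text \<open>Left invariance of \<open>theta\<close>: the vector
  \<open>u + (1/2) *\<^sub>R br a u\<close> is the image of \<open>u\<close> under the differential
  of left translation by \<open>a\<close>.\<close>

lemma theta_mul: "theta (mul a p) (u + (1/2) *\<^sub>R br a u) = theta p u"
  by (simp add: theta_def mul_def br_simps algebra_simps)

lemma smooth_family_on_theta: "smooth_family_on (T \<times> UNIV) (\<lambda>t x. theta x u)"
proof -
  have "bounded_linear (\<lambda>x. (- 1/2) *\<^sub>R br x u)"
    by (intro bounded_linear_const_scaleR bounded_bilinear.bounded_linear_left[OF bounded_bilinear_br])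
  then have "smooth_family_on (T \<times> UNIV) (\<lambda>t x. u + (- 1/2) *\<^sub>R br x u)"
    by (intro smooth_family_on_add smooth_family_on_const smooth_family_on_linear) auto
  then show ?thesis by (simp add: theta_def)
qed

end

locale weighted_pencil = pencil z1 z2 \<tau> \<epsilon> c1 c2
  for z1 z2 :: "'n::finite" and \<tau> \<epsilon> c1 c2 +
  fixes w :: "'n \<Rightarrow> real"
  assumes w_pos: "w i > 0" and w_tau [simp]: "w (\<tau> i) = w i"
begin

definition ip :: "real^'n \<Rightarrow> real^'n \<Rightarrow> real" where
  "ip x y = (\<Sum>i\<in>UNIV. w i * (x $ i) * (y $ i))"

definition met :: "real^'n \<Rightarrow> real^'n \<Rightarrow> real^'n \<Rightarrow> real" where
  "met p u v = ip (theta p u) (theta p v)"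

lemma bilinear_ip: "bilinear ip"
  unfolding bilinear_def
  by (auto intro!: linearI simp: ip_def algebra_simps sum.distrib sum_distrib_left)

lemma bounded_bilinear_ip: "bounded_bilinear ip"
  using bilinear_ip bilinear_conv_bounded_bilinear by blast

lemmas ip_simps = bilinear_ladd[OF bilinear_ip] bilinear_radd[OF bilinear_ip]
  bilinear_lmul[OF bilinear_ip] bilinear_rmul[OF bilinear_ip] bilinear_lneg[OF bilinear_ip]
  bilinear_rneg[OF bilinear_ip] bilinear_lzero[OF bilinear_ip] bilinear_rzero[OF bilinear_ip]
  bilinear_lsub[OF bilinear_ip] bilinear_rsub[OF bilinear_ip]

lemma ip_commute: "ip x y = ip y x"
  by (simp add: ip_def mult_ac)

lemma ip_pos: "x \<noteq> 0 \<Longrightarrow> ip x x > 0"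
proof -
  assume "x \<noteq> 0"
  then obtain i where "x $ i \<noteq> 0" by (auto simp: vec_eq_iff)
  then show ?thesis unfolding ip_def mult.assoc
    by (intro sum_pos2[of _ i]) (auto simp: w_pos less_imp_le mult_nonneg_nonneg zero_less_mult_iff
        not_square_less_zero linorder_neq_iff)
qed

lemma ip_axis: "ip x (axis i 1) = w i * x $ i"
  by (simp add: ip_def axis_def if_distrib[of "\<lambda>r. _ * r"] cong: if_cong)

lemma ip_br: "ip x (br y z) = w z1 * x $ z1 * form c1 y z + w z2 * x $ z2 * form c2 y z"
  by (simp add: br_def ip_simps ip_axis)

lemma met_has_derivative:
  "((\<lambda>x. met x a b) has_derivative
     (\<lambda>z. - (1/2) * (ip (theta p a) (br z b) + ip (br z a) (theta p b)))) (at p)"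
proof -
  have t: "((\<lambda>x. theta x a) has_derivative (\<lambda>z. - (1/2) *\<^sub>R br z a)) (at p)" for a
    unfolding theta_def
    using bounded_linear_imp_has_derivative[OF bounded_bilinear.bounded_linear_left[OF bounded_bilinear_br]]
    by (auto intro!: derivative_eq_intros)
  show ?thesis unfolding met_def
    using bounded_bilinear.FDERIV[OF bounded_bilinear_ip t[of a] t[of b]]
    by (simp add: ip_simps algebra_simps)
qed

text \<open>The geodesic equation has equal first arguments. Then the terms with
  \<open>br u u\<close> vanish and the others combine by skew symmetry of the bracket.\<close>

lemma christoffel_met:
  "christoffel (\<lambda>p c. met p) (UNIV, id) p u u v = - ip (theta p u) (br u v)"
proof -
  have d: "frechet_derivative (\<lambda>x. met x a b) (at p)
      = (\<lambda>z. - (1/2) * (ip (theta p a) (br z b) + ip (br z a) (theta p b)))" for a b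
    using frechet_derivative_at[OF met_has_derivative] by metis
  show ?thesis
    using br_skew[of v u]
    by (simp add: christoffel_def d Let_def ip_simps ip_commute[of "br _ _"])
qed

lemma riemannian_metric_met: "riemannian_metric chart_space (\<lambda>p c. met p)"
proof -
  have "bilinear (met p)" for p
    unfolding bilinear_def met_def
    by (auto intro!: linearI simp: linear_add[OF linear_theta] linear_scale[OF linear_theta] ip_simps)
  moreover have "met p u v = met p v u" for p u v
    by (simp add: met_def ip_commute)
  moreover have "u \<noteq> 0 \<Longrightarrow> met p u u > 0" for p u
    unfolding met_def using theta_eq_0 ip_pos by blast
  moreover have "smooth_on UNIV (\<lambda>x. met x u v)" for u v
  proof -
    have "smooth_family_on ((UNIV :: real set) \<times> UNIV) (\<lambda>t x. met x u v)"
      unfolding met_def by (intro smooth_family_on_bilinear[OF bounded_bilinear_ip] smooth_family_on_theta)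
    then show ?thesis using smooth_family_on_imp_smooth_on by blast
  qed
  moreover have "preserves_metric chart_space (\<lambda>p c. met p) id"
    by (rule preserves_metric_affine[of id _ 0]) (auto simp: linear_id[unfolded id_def] id_def)
  ultimately show ?thesis
    by (simp add: riemannian_metric_def)
qed

lemma affine_isometry_mul: "affine_isometry met (mul a)"
proof (rule affine_isometryI)
  have lin: "linear (\<lambda>x. x + (1/2) *\<^sub>R br a x)" for a
    by (rule linearI) (simp_all add: br_simps algebra_simps)
  show "linear (\<lambda>x. x + (1/2) *\<^sub>R br a x)" "linear (\<lambda>x. x + (1/2) *\<^sub>R br (- a) x)"
    by (rule lin)+
  show e: "mul a x = a + (x + (1/2) *\<^sub>R br a x)" for a x by (simp add: mul_def)
  show "mul a (- a + (x + (1/2) *\<^sub>R br (- a) x)) = x" "- a + (mul a x + (1/2) *\<^sub>R br (- a) (mul a x)) = x" for x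
    by (simp_all only: e[symmetric] mul_cancel)
  show "met (mul a p) (u + (1/2) *\<^sub>R br a u) (v + (1/2) *\<^sub>R br a v) = met p u v" for p u v
    by (simp add: met_def theta_mul)
qed

lemma left_invariant_met: "left_invariant chart_space grp (\<lambda>p c. met p)"
  by (simp add: left_invariant_def affine_isometry_imp_isometry[OF affine_isometry_mul])

end

section \<open>Rotations and geodesics\<close>

lemma zero_derivative_on_interval:
  fixes f :: "real \<Rightarrow> real"
  assumes "is_interval I" "\<And>t. t \<in> I \<Longrightarrow> (f has_real_derivative 0) (at t)" "s \<in> I" "t \<in> I"
  shows "f s = f t"
proof -
  have "convex I" using assms(1) by (simp add: is_interval_convex)
  moreover have "(f has_real_derivative 0) (at t within I)" if "t \<in> I" for t
    using assms(2)[OF that] by (rule has_field_derivative_at_within)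
  ultimately obtain c where "\<And>t. t \<in> I \<Longrightarrow> f t = c"
    using has_field_derivative_zero_constant[of I f] by blast
  then show ?thesis using assms(3,4) by simp
qed

text \<open>Here \<open>x\<close> and \<open>x'\<close> are the two coordinates of a vector in a
  plane, and \<open>e\<close> is the sign at the first one. This lemma and the next say that a
  rotation preserves inner product and oriented area.\<close>

lemma rotation_inner:
  fixes C S e :: real
  assumes "C * C + S * S = 1" "e * e = 1"
  shows "(C * x + S * (e * x')) * (C * y + S * (e * y')) + (C * x' - S * (e * x)) * (C * y' - S * (e * y))
      = x * y + x' * y'"
  using assms by algebra

lemma rotation_det:
  fixes C S e :: real
  assumes "C * C + S * S = 1" "e * e = 1"
  shows "(C * x' - S * (e * x)) * (C * y + S * (e * y')) - (C * x + S * (e * x')) * (C * y' - S * (e * y))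
      = x' * y - x * y'"
  using assms by algebra

context plane_frame
begin

text \<open>Lets an identity between sums over all coordinates be checked one plane at a
  time.\<close>

lemma sum_pair_cong:
  fixes f g :: "'n \<Rightarrow> real"
  assumes "\<And>i. f i + f (\<tau> i) = g i + g (\<tau> i)"
  shows "sum f UNIV = sum g UNIV"
proof -
  have "(\<Sum>i\<in>UNIV. f i + f (\<tau> i)) = (\<Sum>i\<in>UNIV. g i + g (\<tau> i))"
    using assms by simp
  then show ?thesis by (simp add: sum.distrib sum_tau)
qed

lemma rot_nth [simp]: "rot \<mu> t x $ i = cos (\<mu> i * t) * x $ i + sin (\<mu> i * t) * (\<epsilon> i * x $ \<tau> i)"
  by (simp add: rot_def)

lemma linear_rot: "linear (rot \<mu> t)"
  by (rule linearI) (auto simp: vec_eq_iff algebra_simps)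

lemma rot_0 [simp]: "rot \<mu> 0 x = x"
  by (simp add: vec_eq_iff)

end

context weighted_pencil
begin

context
  fixes \<mu> :: "'n \<Rightarrow> real"
  assumes mu_tau [simp]: "\<And>i. \<mu> (\<tau> i) = \<mu> i" and mu_central: "\<And>i. \<epsilon> i = 0 \<Longrightarrow> \<mu> i = 0"
begin

lemma rot_add: "rot \<mu> (s + t) x = rot \<mu> s (rot \<mu> t x)"
proof -
  have "rot \<mu> (s + t) x $ i = rot \<mu> s (rot \<mu> t x) $ i" for i
  proof (cases "\<epsilon> i = 0")
    case True
    then show ?thesis using mu_central by simp
  next
    case False
    then show ?thesis using J_J_nth[of i]
      by (simp add: cos_add sin_add distrib_left algebra_simps)
  qed
  then show ?thesis by (simp add: vec_eq_iff)
qed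

lemma form_rot:
  assumes "\<And>i. c (\<tau> i) = c i"
  shows "form c (rot \<mu> t x) (rot \<mu> t y) = form c x y"
  unfolding form_def
proof (rule sum_pair_cong)
  fix i
  show "c i * J (rot \<mu> t x) $ i * rot \<mu> t y $ i + c (\<tau> i) * J (rot \<mu> t x) $ \<tau> i * rot \<mu> t y $ \<tau> i
      = c i * J x $ i * y $ i + c (\<tau> i) * J x $ \<tau> i * y $ \<tau> i"
  proof (cases "\<epsilon> i = 0")
    case False
    have "(cos (\<mu> i * t) * x $ \<tau> i - sin (\<mu> i * t) * (\<epsilon> i * x $ i)) * (cos (\<mu> i * t) * y $ i + sin (\<mu> i * t) * (\<epsilon> i * y $ \<tau> i))
     - (cos (\<mu> i * t) * x $ i + sin (\<mu> i * t) * (\<epsilon> i * x $ \<tau> i)) * (cos (\<mu> i * t) * y $ \<tau> i - sin (\<mu> i * t) * (\<epsilon> i * y $ i))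
       = x $ \<tau> i * y $ i - x $ i * y $ \<tau> i"
      using False by (intro rotation_det) (simp_all add: eps_eq_0_iff eps_square)
    from arg_cong[OF this, of "\<lambda>r. c i * \<epsilon> i * r"] show ?thesis
      by (simp add: assms right_diff_distrib mult.assoc) (simp add: algebra_simps)
  qed simp
qed

lemma ip_rot: "ip (rot \<mu> t x) (rot \<mu> t y) = ip x y"
  unfolding ip_def
proof (rule sum_pair_cong)
  fix i
  show "w i * rot \<mu> t x $ i * rot \<mu> t y $ i + w (\<tau> i) * rot \<mu> t x $ \<tau> i * rot \<mu> t y $ \<tau> i
      = w i * x $ i * y $ i + w (\<tau> i) * x $ \<tau> i * y $ \<tau> i"
  proof (cases "\<epsilon> i = 0")
    case True
    then show ?thesis using mu_central by simp
  next
    case False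
    have "(cos (\<mu> i * t) * x $ i + sin (\<mu> i * t) * (\<epsilon> i * x $ \<tau> i)) * (cos (\<mu> i * t) * y $ i + sin (\<mu> i * t) * (\<epsilon> i * y $ \<tau> i))
     + (cos (\<mu> i * t) * x $ \<tau> i - sin (\<mu> i * t) * (\<epsilon> i * x $ i)) * (cos (\<mu> i * t) * y $ \<tau> i - sin (\<mu> i * t) * (\<epsilon> i * y $ i))
       = x $ i * y $ i + x $ \<tau> i * y $ \<tau> i"
      using False by (intro rotation_inner) (simp_all add: eps_eq_0_iff eps_square)
    from arg_cong[OF this, of "\<lambda>r. w i * r"] show ?thesis
      by (simp add: algebra_simps)
  qed
qed

lemma rot_br: "rot \<mu> t (br x y) = br x y"
proof -
  have "rot \<mu> t (br x y) $ i = br x y $ i" for i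
  proof (cases "\<epsilon> i = 0")
    case True
    then show ?thesis using mu_central by simp
  next
    case False
    then have "br x y $ i = 0" "br x y $ \<tau> i = 0"
      using eps_eq_0_iff[of i] eps_eq_0_iff[of "\<tau> i"] by (auto simp: br_nth)
    then show ?thesis by simp
  qed
  then show ?thesis by (simp add: vec_eq_iff)
qed

lemma br_rot: "br (rot \<mu> t x) (rot \<mu> t y) = br x y"
  by (simp add: br_def form_rot)

text \<open>Rotations are automorphisms, because they fix z and preserve the area form of each
  plane.\<close>

lemma rot_mul: "rot \<mu> t (mul x y) = mul (rot \<mu> t x) (rot \<mu> t y)"
  by (simp add: mul_def linear_add[OF linear_rot] linear_scale[OF linear_rot] rot_br br_rot)

lemma affine_isometry_rot: "affine_isometry met (rot \<mu> t)"
proof (rule affine_isometryI[OF linear_rot linear_rot])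
  show "rot \<mu> t x = 0 + rot \<mu> t x" for x by simp
  show "rot \<mu> t (0 + rot \<mu> (- t) x) = x" "0 + rot \<mu> (- t) (rot \<mu> t x) = x" for x
    by (simp_all flip: rot_add)
  have "theta (rot \<mu> t p) (rot \<mu> t u) = rot \<mu> t (theta p u)" for p u
    by (simp add: theta_def linear_diff[OF linear_rot] linear_scale[OF linear_rot] rot_br br_rot)
  then show "met (rot \<mu> t p) (rot \<mu> t u) (rot \<mu> t v) = met p u v" for p u v
    by (simp add: met_def ip_rot)
qed

text \<open>The condition on \<open>Y\<close> says that the rotations fix \<open>Y\<close>. Hence
  left translations by \<open>t *\<^sub>R Y\<close> commute with them, and the composites form a
  one-parameter group, conjugated here by left translation by \<open>m\<close>.\<close>

lemma one_parameter_group_screw: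
  assumes Y: "\<And>i. \<mu> i \<noteq> 0 \<Longrightarrow> Y $ i = 0"
  shows "one_parameter_isometry_group chart_space (\<lambda>p c. met p)
    (\<lambda>t x. mul m (mul (t *\<^sub>R Y) (rot \<mu> t (mul (- m) x))))"
  unfolding one_parameter_isometry_group_def
proof (intro conjI allI ballI)
  show "isometry chart_space (\<lambda>p c. met p) (\<lambda>x. mul m (mul (t *\<^sub>R Y) (rot \<mu> t (mul (- m) x))))" for t
    by (intro affine_isometry_imp_isometry affine_isometry_comp[OF affine_isometry_mul]
        affine_isometry_comp[OF affine_isometry_rot] affine_isometry_mul)
  have Yt: "Y $ \<tau> i = 0" if "\<mu> i \<noteq> 0" for i
    using Y[of "\<tau> i"] that by simp
  have fix_Y: "rot \<mu> s (t *\<^sub>R Y) = t *\<^sub>R Y" for s t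
  proof -
    have "rot \<mu> s (t *\<^sub>R Y) $ i = (t *\<^sub>R Y) $ i" for i
      using Y Yt by (cases "\<mu> i = 0") auto
    then show ?thesis by (simp add: vec_eq_iff)
  qed
  have add_Y: "mul (s *\<^sub>R Y) (t *\<^sub>R Y) = (s + t) *\<^sub>R Y" for s t
    by (simp add: mul_def br_simps algebra_simps)
  show "mul m (mul ((s + t) *\<^sub>R Y) (rot \<mu> (s + t) (mul (- m) x)))
     = mul m (mul (s *\<^sub>R Y) (rot \<mu> s (mul (- m) (mul m (mul (t *\<^sub>R Y) (rot \<mu> t (mul (- m) x)))))))" for s t x
    by (simp add: rot_mul fix_Y rot_add flip: mul_assoc add_Y)
  have "continuous_on UNIV (\<lambda>z. mul m (mul (fst z *\<^sub>R Y) (rot \<mu> (fst z) (mul (- m) (snd z)))))"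
    unfolding mul_def rot_def J_def
    by (intro continuous_intros bounded_bilinear.continuous_on[OF bounded_bilinear_br] continuous_on_vec_lambda) simp_all
  then show "continuous_map (prod_topology euclideanreal (mtop chart_space)) (mtop chart_space)
      (\<lambda>(t, x). mul m (mul (t *\<^sub>R Y) (rot \<mu> t (mul (- m) x))))"
    by (simp add: euclidean_product_topology case_prod_beta)
qed

end

section \<open>Integration of the geodesic equation\<close>

lemma geodesic_equation:
  assumes "geodesic chart_space (\<lambda>p c. met p) I \<gamma>"
  obtains v a where
    "\<And>t. t \<in> I \<Longrightarrow> (\<gamma> has_vector_derivative v t) (at t)"
    "\<And>t. t \<in> I \<Longrightarrow> (v has_vector_derivative a t) (at t)"
    "\<And>t y. t \<in> I \<Longrightarrow> ip (theta (\<gamma> t) (a t)) y = ip (theta (\<gamma> t) (v t)) (br (v t) y)"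
proof -
  obtain v a where va: "\<forall>t\<in>I. (\<gamma> has_vector_derivative v t) (at t) \<and> (v has_vector_derivative a t) (at t) \<and>
      (\<forall>y. met (\<gamma> t) (a t) y - ip (theta (\<gamma> t) (v t)) (br (v t) y) = 0)"
    using assms by (auto simp: geodesic_def christoffel_met)
  have "ip (theta (\<gamma> t) (a t)) y = ip (theta (\<gamma> t) (v t)) (br (v t) y)" if "t \<in> I" for t y
  proof -
    \<comment> \<open>The test vector is the preimage of \<open>y\<close> under
      \<open>theta\<close>, so the equation is expressed in the left-invariant frame.\<close>
    have "theta (\<gamma> t) (y + (1/2) *\<^sub>R br (\<gamma> t) y) = y"
      by (simp add: theta_def br_simps)
    moreover have "br (v t) (y + (1/2) *\<^sub>R br (\<gamma> t) y) = br (v t) y"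
      by (simp add: br_simps)
    ultimately show ?thesis
      using bspec[OF va that] by (metis met_def eq_iff_diff_eq_0)
  qed
  with va show ?thesis using that by blast
qed

end

context weighted_pencil
begin

text \<open>The central components of the left-invariant velocity are conserved, which makes the
  equation on v linear. In each plane the motion is a straight line or a uniform rotation about a
  fixed point; the central coordinates are then found by one more integration.\<close>

lemma geodesic_is_screw_orbit:
  assumes "geodesic chart_space (\<lambda>p c. met p) I \<gamma>"
  obtains \<mu> m Y b where
    "\<And>i. \<mu> (\<tau> i) = \<mu> i" "\<And>i. \<epsilon> i = 0 \<Longrightarrow> \<mu> i = 0" "\<And>i. \<mu> i \<noteq> 0 \<Longrightarrow> Y $ i = 0"
    "\<And>t. t \<in> I \<Longrightarrow> \<gamma> t = mul m (mul (t *\<^sub>R Y) (rot \<mu> t b))"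
proof -
  obtain v a where
    g1: "\<And>t. t \<in> I \<Longrightarrow> (\<gamma> has_vector_derivative v t) (at t)" and
    g2: "\<And>t. t \<in> I \<Longrightarrow> (v has_vector_derivative a t) (at t)" and
    eq: "\<And>t y. t \<in> I \<Longrightarrow> ip (theta (\<gamma> t) (a t)) y = ip (theta (\<gamma> t) (v t)) (br (v t) y)"
    using geodesic_equation[OF assms] by blast
  from assms have I: "is_interval I" and "I \<noteq> {}" by (auto simp: geodesic_def)
  then obtain t0 where t0: "t0 \<in> I" by blast
  note const = zero_derivative_on_interval[OF I _ _ t0]
  have nth_deriv: "((\<lambda>t. f t $ i) has_real_derivative f' $ i) (at t)"
    if "(f has_vector_derivative f') (at t)" for f f' t and i :: 'n
    using bounded_linear.has_vector_derivative[OF bounded_linear_vec_nth that]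
    by (simp add: has_real_derivative_iff_has_vector_derivative)
  note d1 = nth_deriv[OF g1] and d2 = nth_deriv[OF g2]
  define U where "U t = theta (\<gamma> t) (v t)" for t
  have eqi: "w i * theta (\<gamma> t) (a t) $ i
      = (w z1 * U t $ z1 * c1 i + w z2 * U t $ z2 * c2 i) * (\<epsilon> i * v t $ \<tau> i)" if "t \<in> I" for t i
    using eq[OF that, of "axis i 1"] by (simp add: ip_axis ip_br form_axis U_def algebra_simps)
  have dU: "(U has_vector_derivative theta (\<gamma> t) (a t)) (at t)" if "t \<in> I" for t
    unfolding U_def theta_def
    using bounded_bilinear.has_vector_derivative[OF bounded_bilinear_br g1[OF that] g2[OF that]] g2[OF that]
    by (auto intro!: derivative_eq_intros)
  \<comment> \<open>At a central coordinate the right side of \<open>eqi\<close> contains the factor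
    \<open>\<epsilon> z = 0\<close>.\<close>
  have U_const: "U t $ z = U t0 $ z" if "\<epsilon> z = 0" "t \<in> I" for z t
  proof (rule const[OF _ that(2)])
    fix t assume t: "t \<in> I"
    have "theta (\<gamma> t) (a t) $ z = 0" using eqi[OF t, of z] that(1) w_pos[of z] by simp
    then show "((\<lambda>t. U t $ z) has_real_derivative 0) (at t)" using nth_deriv[OF dU[OF t], of z] by simp
  qed
  \<comment> \<open>Angular speeds: \<open>\<mu> J\<close> is the skew operator
    \<open>J\<^sub>Z\<close> for the conserved central part of \<open>U\<close>. Division by
    \<open>w i\<close> turns the covector of \<open>eqi\<close> into a vector.\<close>
  define \<mu> where "\<mu> i = (w z1 * U t0 $ z1 * c1 i + w z2 * U t0 $ z2 * c2 i) / w i" for i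
  have mu_tau [simp]: "\<mu> (\<tau> i) = \<mu> i" for i by (simp add: \<mu>_def)
  have mu_central: "\<epsilon> i = 0 \<Longrightarrow> \<mu> i = 0" for i by (simp add: \<mu>_def c_central)
  have acc: "a t $ i = \<mu> i * (\<epsilon> i * v t $ \<tau> i)" if "\<epsilon> i \<noteq> 0" "t \<in> I" for i t
  proof -
    have "theta (\<gamma> t) (a t) $ i = a t $ i"
      using that(1) by (auto simp: theta_def br_nth)
    then show ?thesis
      using eqi[OF that(2), of i] w_pos[of i] that(2) by (simp add: \<mu>_def U_const field_simps)
  qed
  \<comment> \<open>The acceleration on v is \<open>\<mu>\<close> times \<open>J\<close> of the
    velocity, so the velocity minus \<open>\<mu>\<close> times \<open>J\<close> of the position is a
    constant \<open>C\<close>.\<close>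
  define C where "C i = v t0 $ i - \<mu> i * (\<epsilon> i * \<gamma> t0 $ \<tau> i)" for i
  have vel: "v t $ i = C i + \<mu> i * (\<epsilon> i * \<gamma> t $ \<tau> i)" if "\<epsilon> i \<noteq> 0" "t \<in> I" for i t
  proof -
    have "v t $ i - \<mu> i * (\<epsilon> i * \<gamma> t $ \<tau> i) = C i"
      unfolding C_def
      by (rule const[OF _ that(2)]) (auto intro!: derivative_eq_intros d1 d2 simp: acc that(1))
    then show ?thesis by simp
  qed
  \<comment> \<open>In a plane with \<open>\<mu> i \<noteq> 0\<close> this is the center of
    rotation, where the velocity formula vanishes; otherwise it is the position extrapolated
    linearly to time \<open>0\<close>.\<close>
  define m :: "real^'n" where "m = (\<chi> i. if \<epsilon> i = 0 then 0 else if \<mu> i = 0 then \<gamma> t0 $ i - t0 * C i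
     else \<epsilon> i * C (\<tau> i) / \<mu> i)"
  \<comment> \<open>The position relative to the center at time \<open>t0\<close>, rotated back to
    time \<open>0\<close>.\<close>
  define b' :: "real^'n" where "b' = (\<chi> i. if \<epsilon> i = 0 \<or> \<mu> i = 0 then 0
     else cos (\<mu> i * t0) * (\<gamma> t0 $ i - m $ i) - sin (\<mu> i * t0) * (\<epsilon> i * (\<gamma> t0 $ \<tau> i - m $ \<tau> i)))"
  define Y' :: "real^'n" where "Y' = (\<chi> i. if \<epsilon> i = 0 \<or> \<mu> i \<noteq> 0 then 0 else C i)"
  have C_eq: "C i = - (\<mu> i * (\<epsilon> i * m $ \<tau> i))" if "\<epsilon> i \<noteq> 0" "\<mu> i \<noteq> 0" for i
    using that J_J_nth[of i "C i"] by (simp add: m_def)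
  have pos: "\<gamma> t $ i = m $ i + t * Y' $ i + rot \<mu> t b' $ i" if i: "\<epsilon> i \<noteq> 0" and t: "t \<in> I" for i t
  proof (cases "\<mu> i = 0")
    case True
    have "\<gamma> t $ i - t * C i = \<gamma> t0 $ i - t0 * C i"
      by (rule const[OF _ t]) (auto intro!: derivative_eq_intros d1 simp: vel i True)
    then show ?thesis using i True by (simp add: m_def Y'_def b'_def)
  next
    case False
    define u where "u t i = \<gamma> t $ i - m $ i" for t i
    have du: "((\<lambda>t. u t j) has_real_derivative \<mu> i * (\<epsilon> j * u t (\<tau> j))) (at t)"
      if "j = i \<or> j = \<tau> i" "t \<in> I" for j t
      unfolding u_def using that i False
      by (auto intro!: derivative_eq_intros d1 simp: vel C_eq algebra_simps)
    \<comment> \<open>Rotating the relative position back by the elapsed angle gives a constant, as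
      its derivative vanishes.\<close>
    have b: "cos (\<mu> i * t) * u t j - sin (\<mu> i * t) * (\<epsilon> j * u t (\<tau> j)) = b' $ j"
      if j: "j = i \<or> j = \<tau> i" for j
    proof -
      have mu_j: "\<mu> j = \<mu> i" "\<epsilon> j \<noteq> 0" "\<tau> j = i \<or> \<tau> j = \<tau> i" using j i by auto
      have "cos (\<mu> i * t) * u t j - sin (\<mu> i * t) * (\<epsilon> j * u t (\<tau> j))
          = cos (\<mu> i * t0) * u t0 j - sin (\<mu> i * t0) * (\<epsilon> j * u t0 (\<tau> j))"
      proof (rule const[OF _ t])
        fix t assume t: "t \<in> I"
        show "((\<lambda>t. cos (\<mu> i * t) * u t j - sin (\<mu> i * t) * (\<epsilon> j * u t (\<tau> j))) has_real_derivative 0) (at t)"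
          using J_J_nth[OF mu_j(2), of "u t j"]
          by (auto intro!: derivative_eq_intros du[OF j t] du[OF mu_j(3) t] simp: algebra_simps)
      qed
      then show ?thesis using mu_j False by (simp add: b'_def u_def)
    qed
    have e: "\<epsilon> i * \<epsilon> i = 1" using i by (simp add: eps_eq_0_iff eps_square)
    have "rot \<mu> t b' $ i = u t i"
      unfolding rot_nth b[OF disjI1[OF refl], symmetric] b[OF disjI2[OF refl], symmetric]
      using sin_cos_squared_add3[of "\<mu> i * t"] e by (simp only: eps_tau tau_tau) algebra
    then show ?thesis using False by (simp add: u_def Y'_def)
  qed
  \<comment> \<open>\<open>M\<close> after \<open>J\<close> generates the rotations, so
    \<open>vel'\<close> splits the velocity into a straight part and a rotating part.\<close>
  define M where "M x = (\<chi> i. \<mu> i * x $ i)" for x :: "real^'n"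
  have vel': "v t $ i = (Y' + M (J (rot \<mu> t b'))) $ i" if i: "\<epsilon> i \<noteq> 0" and t: "t \<in> I" for i t
  proof (cases "\<mu> i = 0")
    case True
    then show ?thesis using i t by (simp add: vel Y'_def M_def)
  next
    case False
    have "\<gamma> t $ \<tau> i - m $ \<tau> i = rot \<mu> t b' $ \<tau> i"
      using pos[of "\<tau> i" t] i t False by (simp add: Y'_def)
    moreover have "v t $ i = \<mu> i * (\<epsilon> i * (\<gamma> t $ \<tau> i - m $ \<tau> i))"
      using vel[OF i t] C_eq[OF i False] by (simp add: algebra_simps)
    ultimately show ?thesis using False by (simp add: Y'_def M_def del: rot_nth)
  qed
  \<comment> \<open>The forms of relative position and velocity are areal velocities. Straight and
    rotating parts occupy different planes, so mixed terms vanish, and the rotating part contributes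
    a constant by \<open>form_rot\<close>.\<close>
  define K where "K c = form (\<lambda>i. c i * \<mu> i) b' (J b')" for c
  have form_const: "form c (\<gamma> t - m) (v t) = K c" if c: "\<And>i. c (\<tau> i) = c i" and t: "t \<in> I" for c t
  proof -
    let ?B = "rot \<mu> t b'"
    have J_B: "J ?B = rot \<mu> t (J b')" by (simp add: vec_eq_iff algebra_simps)
    have "form c (\<gamma> t - m) (v t) = form c (t *\<^sub>R Y' + ?B) (Y' + M (J ?B))"
      by (rule form_cong) (use pos[OF _ t] vel'[OF _ t] in \<open>simp del: rot_nth\<close>)
    also have "\<dots> = t * form c Y' Y' + t * form c Y' (M (J ?B)) + form c ?B Y' + form c ?B (M (J ?B))"
      by (simp add: form_add_left form_add_right form_scaleR_left)
    also have "form c Y' Y' = 0" using form_skew[of c Y' Y'] c by simp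
    also have "form c Y' (M (J ?B)) = 0" by (rule form_eq_0) (simp add: Y'_def M_def)
    also have "form c ?B Y' = 0" by (rule form_eq_0) (simp add: Y'_def b'_def)
    also have "form c ?B (M (J ?B)) = form (\<lambda>i. c i * \<mu> i) ?B (J ?B)"
      by (simp add: form_def M_def mult_ac)
    also have "\<dots> = K c"
    proof -
      have cm: "c (\<tau> i) * \<mu> (\<tau> i) = c i * \<mu> i" for i by (simp only: c mu_tau)
      show ?thesis unfolding K_def J_B by (rule form_rot) (use mu_tau mu_central cm in blast)+
    qed
    finally show ?thesis by simp
  qed
  \<comment> \<open>These are the central coordinates of \<open>mul (- m) (\<gamma> t)\<close>,
    since \<open>m\<close> has none itself. Their speed is the conserved \<open>U\<close> plus half
    the areal velocity, hence constant.\<close>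
  have center: "(\<gamma> t - (1/2) *\<^sub>R br m (\<gamma> t)) $ z - t * (U t0 $ z + K c / 2)
      = (\<gamma> t0 - (1/2) *\<^sub>R br m (\<gamma> t0)) $ z - t0 * (U t0 $ z + K c / 2)"
    if c: "\<And>i. c (\<tau> i) = c i" "\<epsilon> z = 0" "\<And>x y. br x y $ z = form c x y" and t: "t \<in> I" for c z t
  proof (rule const[OF _ t])
    fix t assume t: "t \<in> I"
    have "((\<lambda>t. \<gamma> t - (1/2) *\<^sub>R br m (\<gamma> t)) has_vector_derivative v t - (1/2) *\<^sub>R br m (v t)) (at t)"
      using bounded_bilinear.has_vector_derivative[OF bounded_bilinear_br has_vector_derivative_const[of m] g1[OF t]]
      by (auto intro!: derivative_eq_intros g1[OF t] simp: br_simps)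
    note d = nth_deriv[OF this, of z]
    have "(v t - (1/2) *\<^sub>R br m (v t)) $ z = U t $ z + (1/2) * br (\<gamma> t - m) (v t) $ z"
      by (simp add: U_def theta_def br_simps algebra_simps)
    then have "(v t - (1/2) *\<^sub>R br m (v t)) $ z = U t0 $ z + K c / 2"
      by (simp only: c(3) form_const[where c = c, OF c(1) t] U_const[OF c(2) t])
    from DERIV_diff[OF d[unfolded this] DERIV_cmult_right[OF DERIV_ident, of "U t0 $ z + K c / 2"]]
    show "((\<lambda>t. (\<gamma> t - (1/2) *\<^sub>R br m (\<gamma> t)) $ z - t * (U t0 $ z + K c / 2)) has_real_derivative 0) (at t)"
      by simp
  qed
  \<comment> \<open>Speeds of the two central coordinates; away from these, \<open>k\<close> has a
    default value.\<close>
  define k where "k i = U t0 $ i + K (if i = z1 then c1 else c2) / 2" for i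
  define Y where "Y = (\<chi> i. if \<epsilon> i = 0 then k i else Y' $ i)"
  define b where "b = (\<chi> i. if \<epsilon> i = 0 then (\<gamma> t0 - (1/2) *\<^sub>R br m (\<gamma> t0)) $ i - t0 * k i else b' $ i)"
  have Y_mu: "\<mu> i \<noteq> 0 \<Longrightarrow> Y $ i = 0" for i
    using mu_central by (auto simp: Y_def Y'_def)
  \<comment> \<open>On v the vectors \<open>Y\<close> and \<open>b\<close> are supported on
    different planes, so the bracket vanishes and \<open>mul\<close> reduces to addition.\<close>
  have zero: "br (t *\<^sub>R Y) (rot \<mu> t b) = 0" for t
  proof -
    have "form c Y (rot \<mu> t b) = 0" for c
      by (rule form_eq_0) (simp add: Y_def Y'_def b_def b'_def)
    then show ?thesis by (simp add: br_simps) (simp add: br_def)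
  qed
  have "mul (- m) (\<gamma> t) = mul (t *\<^sub>R Y) (rot \<mu> t b)" if t: "t \<in> I" for t
  proof -
    have "mul (- m) (\<gamma> t) $ i = mul (t *\<^sub>R Y) (rot \<mu> t b) $ i" for i
    proof (cases "\<epsilon> i = 0")
      case False
      then show ?thesis
        using pos[OF False t] by (auto simp: mul_def zero br_nth Y_def b_def)
    next
      case True
      let ?c = "if i = z1 then c1 else c2"
      have br_i: "br x y $ i = form ?c x y" for x y
        using z_distinct True by (auto simp: br_nth eps_eq_0_iff)
      have c: "?c (\<tau> j) = ?c j" for j by simp
      have "mul (- m) (\<gamma> t) $ i = (\<gamma> t - (1/2) *\<^sub>R br m (\<gamma> t)) $ i"
        by (simp add: mul_def br_simps m_def[THEN arg_cong, of "\<lambda>x. x $ i"] True)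
      also have "\<dots> = t * k i + ((\<gamma> t0 - (1/2) *\<^sub>R br m (\<gamma> t0)) $ i - t0 * k i)"
        unfolding k_def using center[where c = ?c, OF c True br_i t] by linarith
      also have "\<dots> = mul (t *\<^sub>R Y) (rot \<mu> t b) $ i"
        unfolding mul_def zero using mu_central[OF True] by (simp add: Y_def b_def True)
      finally show ?thesis .
    qed
    then show ?thesis by (simp add: vec_eq_iff)
  qed
  then have "\<gamma> t = mul m (mul (t *\<^sub>R Y) (rot \<mu> t b))" if "t \<in> I" for t
    using that by (metis mul_cancel(2))
  then show ?thesis using that[of \<mu> Y m b] Y_mu mu_tau mu_central by blast
qed

theorem geodesic_orbit_met: "geodesic_orbit chart_space (\<lambda>p c. met p)"
  unfolding geodesic_orbit_def
proof (intro conjI allI impI riemannian_metric_met)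
  fix I \<gamma>
  assume "geodesic chart_space (\<lambda>p c. met p) I \<gamma>"
  from geodesic_is_screw_orbit[OF this] obtain \<mu> m Y b where *:
    "\<And>i. \<mu> (\<tau> i) = \<mu> i" "\<And>i. \<epsilon> i = 0 \<Longrightarrow> \<mu> i = 0" "\<And>i. \<mu> i \<noteq> 0 \<Longrightarrow> Y $ i = 0"
    "\<And>t. t \<in> I \<Longrightarrow> \<gamma> t = mul m (mul (t *\<^sub>R Y) (rot \<mu> t b))"
    by metis
  \<comment> \<open>The orbit starts at \<open>mul m b\<close>, which the conjugation by
    \<open>m\<close> turns back into \<open>b\<close>.\<close>
  show "\<exists>\<phi> p. one_parameter_isometry_group chart_space (\<lambda>p c. met p) \<phi> \<and>
      p \<in> topspace (mtop chart_space) \<and> (\<forall>t\<in>I. \<gamma> t = \<phi> t p)"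
    using one_parameter_group_screw[where \<mu> = \<mu> and Y = Y and m = m, OF *(1-3)] *(4)
    by (intro exI[of _ "\<lambda>t x. mul m (mul (t *\<^sub>R Y) (rot \<mu> t (mul (- m) x)))"] exI[of _ "mul m b"]) simp
qed

end

section \<open>Isomorphisms\<close>

text \<open>Write \<open>f x\<close> as \<open>n\<close> times \<open>f (x / n)\<close>. The
  derivative \<open>L\<close> at 0 makes the error at \<open>x / n\<close> at most
  \<open>e * norm x / n\<close> for large \<open>n\<close>, so \<open>f x\<close> and
  \<open>L x\<close> differ by at most \<open>e * norm x\<close> for every
  \<open>e > 0\<close>.\<close>

lemma homogeneous_differentiable_imp_linear:
  fixes f :: "'a::real_normed_vector \<Rightarrow> 'b::real_normed_vector"
  assumes d: "f differentiable (at 0)" and hom: "\<And>n x. f (of_nat n *\<^sub>R x) = of_nat n *\<^sub>R f x"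
  shows "linear f"
proof -
  obtain L where L: "(f has_derivative L) (at 0)" using d by (auto simp: differentiable_def)
  then have lin: "linear L" by (rule has_derivative_linear)
  have f0: "f 0 = 0" using hom[of 0 0] by simp
  have "f x = L x" for x
  proof -
    have "norm (f x - L x) \<le> e * norm x" if "e > 0" for e
    proof -
      obtain \<delta> where \<delta>: "\<delta> > 0" "\<And>y. norm y < \<delta> \<Longrightarrow> norm (f y - L y) \<le> e * norm y"
        using L \<open>e > 0\<close> unfolding has_derivative_at_alt by (auto simp: f0)
      obtain n :: nat where n: "norm x / \<delta> < real n" using reals_Archimedean2 by blast
      have "n > 0" using n \<delta>(1) by (cases n) (auto simp: field_simps not_less)
      define y where "y = (1 / real n) *\<^sub>R x"
      have x: "x = real n *\<^sub>R y" using \<open>n > 0\<close> by (simp add: y_def)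
      have "norm y < \<delta>" using n \<delta>(1) \<open>n > 0\<close> by (simp add: y_def field_simps)
      then have "norm (f y - L y) \<le> e * norm y" by (rule \<delta>)
      moreover have "f x - L x = real n *\<^sub>R (f y - L y)"
        using hom[of n y] by (simp add: x linear_scale[OF lin] scaleR_diff_right)
      ultimately show ?thesis using mult_left_mono[of "norm (f y - L y)" "e * norm y" "real n"]
        by (simp add: x mult.left_commute)
    qed
    then have "norm (f x - L x) \<le> 0"
    proof (cases "x = 0")
      case False
      show ?thesis
      proof (rule field_le_epsilon)
        fix e :: real assume "e > 0"
        then show "norm (f x - L x) \<le> 0 + e"
          using \<open>\<And>e. e > 0 \<Longrightarrow> norm (f x - L x) \<le> e * norm x\<close>[of "e / norm x"] False by simp
      qed
    qed (simp add: f0 linear_0[OF lin])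
    then show ?thesis by simp
  qed
  then have "f = L" by blast
  then show ?thesis using lin by simp
qed

lemma dim_coordinate_subspace:
  "dim {x :: real^'n. \<forall>i. i \<notin> A \<longrightarrow> x $ i = 0} = card A"
proof -
  let ?d = "(\<lambda>i. axis i (1::real)) ` A"
  have "(\<forall>i\<in>Basis. i \<notin> ?d \<longrightarrow> x \<bullet> i = 0) \<longleftrightarrow> (\<forall>i. i \<notin> A \<longrightarrow> x $ i = 0)" for x :: "real^'n"
    by (auto simp: Basis_vec_def inner_axis axis_eq_axis)
  moreover have "?d \<subseteq> Basis" by (auto simp: Basis_vec_def)
  moreover have "card ?d = card A" by (rule card_image) (auto simp: inj_on_def axis_eq_axis)
  ultimately show ?thesis using dim_substandard[of ?d] by simp
qed

context plane_frame
begin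

text \<open>The radical is a coordinate subspace: testing against coordinate vectors forces exactly
  the coordinates of nonzero weight to vanish.\<close>

lemma dim_form_kernel:
  assumes "\<And>i. c (\<tau> i) = c i"
  shows "dim {x. \<forall>y. form c x y = 0} = card {i. c i * \<epsilon> i = 0}"
proof -
  have "(\<forall>y. form c x y = 0) \<longleftrightarrow> (\<forall>i. i \<notin> {i. c i * \<epsilon> i = 0} \<longrightarrow> x $ i = 0)" for x
  proof
    assume "\<forall>y. form c x y = 0"
    then have "c (\<tau> i) * J x $ \<tau> i = 0" for i by (metis form_axis)
    then show "\<forall>i. i \<notin> {i. c i * \<epsilon> i = 0} \<longrightarrow> x $ i = 0" by (auto simp: assms)
  next
    assume *: "\<forall>i. i \<notin> {i. c i * \<epsilon> i = 0} \<longrightarrow> x $ i = 0"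
    show "\<forall>y. form c x y = 0"
    proof
      show "form c x y = 0" for y
        by (rule form_eq_0) (use * assms in auto)
    qed
  qed
  then show ?thesis using dim_coordinate_subspace[of "{i. c i * \<epsilon> i = 0}"] by simp
qed

end

context pencil
begin

text \<open>Each vector attached to a plane is itself a bracket; with two independent ones this
  shows that an isomorphism maps z into z.\<close>

lemma center_eq_br:
  assumes "\<epsilon> i \<noteq> 0"
  shows "br (\<epsilon> i *\<^sub>R axis (\<tau> i) 1) (axis i 1) = c1 i *\<^sub>R axis z1 1 + c2 i *\<^sub>R axis z2 1"
  using assms by (simp add: br_def form_axis eps_eq_0_iff eps_square)

lemma br_eq_axes: "br x y = (br x y $ z1) *\<^sub>R axis z1 1 + (br x y $ z2) *\<^sub>R axis z2 1"
  using z_distinct by (simp add: br_def axis_def)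

end

text \<open>In exponential coordinates the \<open>n\<close>-th power is multiplication by
  \<open>n\<close>, so a smooth homomorphism is homogeneous and therefore linear. Comparing the two
  products then shows that it preserves brackets.\<close>

lemma (in plane_frame) lie_isomorphic_imp_linear:
  assumes "pencil z1 z2 \<tau> \<epsilon> c1 c2" "pencil z1 z2 \<tau> \<epsilon> d1 d2"
    and "lie_isomorphic chart_space (pencil.grp z1 z2 \<tau> \<epsilon> c1 c2) chart_space (pencil.grp z1 z2 \<tau> \<epsilon> d1 d2)"
  obtains f where "linear f" "inj f"
    "\<And>x y. f (pencil.br z1 z2 \<tau> \<epsilon> c1 c2 x y) = pencil.br z1 z2 \<tau> \<epsilon> d1 d2 (f x) (f y)"
proof -
  interpret P: pencil z1 z2 \<tau> \<epsilon> c1 c2 by fact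
  interpret Q: pencil z1 z2 \<tau> \<epsilon> d1 d2 by fact
  obtain f where iso: "f \<in> iso P.grp Q.grp" and diff: "diffeomorphism chart_space chart_space f"
    using assms(3) unfolding lie_isomorphic_def by blast
  have hom: "f (P.mul x y) = Q.mul (f x) (f y)" for x y
    using iso by (simp add: iso_def hom_def)
  have inj: "inj f" using iso by (simp add: iso_def bij_betw_def)
  have "smooth_on UNIV f" using diff by (simp add: diffeomorphism_def smooth_map_chart_space)
  then have "Ck_on (Suc 0) UNIV f" unfolding smooth_on_def by blast
  then have d: "f differentiable (at 0)" by simp
  have f0: "f 0 = 0" using hom[of 0 0] Q.mul_cancel(1)[of "f 0" "f 0"] by simp
  have "f (of_nat n *\<^sub>R x) = of_nat n *\<^sub>R f x" for n x
  proof (induction n)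
    case (Suc n)
    have "P.mul (of_nat n *\<^sub>R x) x = of_nat (Suc n) *\<^sub>R x"
      by (simp add: P.mul_def P.br_simps algebra_simps)
    moreover have "Q.mul (of_nat n *\<^sub>R f x) (f x) = of_nat (Suc n) *\<^sub>R f x"
      by (simp add: Q.mul_def Q.br_simps algebra_simps)
    ultimately show ?case using hom[of "of_nat n *\<^sub>R x" x] Suc by simp
  qed (simp add: f0)
  with d have lin: "linear f" by (rule homogeneous_differentiable_imp_linear)
  have "f (P.br x y) = Q.br (f x) (f y)" for x y
    using hom[of x y] by (simp add: P.mul_def Q.mul_def linear_add[OF lin] linear_scale[OF lin])
  with lin inj show ?thesis by (rule that)
qed

text \<open>The matrix with rows \<open>p q\<close> and \<open>r s\<close> is the restriction of the
  isomorphism to z, which \<open>i\<close> and \<open>j\<close> show to be spanned by brackets. A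
  form of the second pencil pulls back to a form of the first, so their radicals have equal
  dimension, counted on the two sides.\<close>

lemma (in plane_frame) lie_isomorphic_imp_equivalent_pencils:
  assumes P: "pencil z1 z2 \<tau> \<epsilon> c1 c2" and Q: "pencil z1 z2 \<tau> \<epsilon> d1 d2"
    and iso: "lie_isomorphic chart_space (pencil.grp z1 z2 \<tau> \<epsilon> c1 c2) chart_space (pencil.grp z1 z2 \<tau> \<epsilon> d1 d2)"
    and ij: "\<epsilon> i \<noteq> 0" "c1 i = 1" "c2 i = 0" "\<epsilon> j \<noteq> 0" "c1 j = 0" "c2 j = 1"
  obtains p q r s where "p * s \<noteq> q * r"
    "\<And>x y. card {i. ((x * p + y * r) * c1 i + (x * q + y * s) * c2 i) * \<epsilon> i = 0}
         = card {i. (x * d1 i + y * d2 i) * \<epsilon> i = 0}"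
proof -
  interpret P: pencil z1 z2 \<tau> \<epsilon> c1 c2 by fact
  interpret Q: pencil z1 z2 \<tau> \<epsilon> d1 d2 by fact
  obtain f where lin: "linear f" and inj: "inj f"
    and br: "\<And>x y. f (P.br x y) = Q.br (f x) (f y)"
    using lie_isomorphic_imp_linear[OF P Q iso] by blast
  define p r q s where "p = f (axis z1 1) $ z1" "r = f (axis z1 1) $ z2"
    "q = f (axis z2 1) $ z1" "s = f (axis z2 1) $ z2"
  note defs = this
  have f1: "f (axis z1 1) = p *\<^sub>R axis z1 1 + r *\<^sub>R axis z2 1"
    using Q.br_eq_axes br P.center_eq_br[OF ij(1)] ij unfolding defs by (metis add.right_neutral scaleR_one scaleR_zero_left)
  have f2: "f (axis z2 1) = q *\<^sub>R axis z1 1 + s *\<^sub>R axis z2 1"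
    using Q.br_eq_axes br P.center_eq_br[OF ij(4)] ij unfolding defs by (metis add.left_neutral scaleR_one scaleR_zero_left)
  have comb: "f (x *\<^sub>R axis z1 1 + y *\<^sub>R axis z2 1) = (x * p + y * q) *\<^sub>R axis z1 1 + (x * r + y * s) *\<^sub>R axis z2 1" for x y
    by (simp add: linear_add[OF lin] linear_scale[OF lin] f1 f2 algebra_simps)
  have ker: "x = 0 \<and> y = 0" if "x * p + y * q = 0" "x * r + y * s = 0" for x y
  proof -
    have "x *\<^sub>R axis z1 1 + y *\<^sub>R axis z2 (1::real) = 0"
      using comb[of x y] that linear_injective_0[OF lin] inj by simp
    from arg_cong[OF this, of "\<lambda>v. v $ z1"] arg_cong[OF this, of "\<lambda>v. v $ z2"] show ?thesis
      using z_distinct by (auto simp: axis_def)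
  qed
  have "p * s \<noteq> q * r"
  proof
    assume "p * s = q * r"
    \<comment> \<open>For a singular matrix the vectors \<open>(s, - r)\<close> and
      \<open>(q, - p)\<close> lie in its kernel, which is trivial; so all entries vanish.\<close>
    then have "s = 0 \<and> - r = 0" "q = 0 \<and> - p = 0"
      by (intro ker; simp add: mult.commute)+
    with ker[of 1 0] show False by simp
  qed
  moreover have "card {i. ((x * p + y * r) * c1 i + (x * q + y * s) * c2 i) * \<epsilon> i = 0}
         = card {i. (x * d1 i + y * d2 i) * \<epsilon> i = 0}" for x y
  proof -
    let ?c = "\<lambda>i. (x * p + y * r) * c1 i + (x * q + y * s) * c2 i" and ?d = "\<lambda>i. x * d1 i + y * d2 i"
    have lin_form: "form (\<lambda>i. x * c i + y * d i) u v = x * form c u v + y * form d u v" for x y c d u v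
      by (simp add: form_def algebra_simps sum.distrib sum_distrib_left)
    have "form ?d (f u) (f v) = form ?c u v" for u v
    proof -
      have "Q.br (f u) (f v) = f (form c1 u v *\<^sub>R axis z1 1 + form c2 u v *\<^sub>R axis z2 1)"
        using br[of u v] by (simp add: P.br_def)
      note this[unfolded comb]
      from arg_cong[OF this, of "\<lambda>v. v $ z1"] arg_cong[OF this, of "\<lambda>v. v $ z2"]
      have "form d1 (f u) (f v) = form c1 u v * p + form c2 u v * q"
        "form d2 (f u) (f v) = form c1 u v * r + form c2 u v * s"
        using z_distinct by (auto simp: Q.br_nth axis_def)
      then show ?thesis unfolding lin_form by (simp add: algebra_simps)
    qed
    then have ker_iff: "(\<forall>v. form ?d (f u) (f v) = 0) \<longleftrightarrow> (\<forall>v. form ?c u v = 0)" for u by simp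
    have "surj f" using lin inj by (rule linear_inj_imp_surj)
    then have surj_all: "(\<forall>v. P v) \<longleftrightarrow> (\<forall>v. P (f v))" for P by (metis surjD)
    have mem: "(\<forall>v. form ?d (f u) v = 0) \<longleftrightarrow> (\<forall>v. form ?c u v = 0)" for u
      unfolding surj_all[of "\<lambda>v. form ?d (f u) v = 0"] by (rule ker_iff)
    have "{x. \<forall>y. form ?d x y = 0} = f ` {x. \<forall>y. form ?c x y = 0}"
    proof (intro equalityI subsetI)
      fix x assume x: "x \<in> {x. \<forall>y. form ?d x y = 0}"
      obtain u where u: "x = f u" using \<open>surj f\<close> by (rule surjE)
      then have "u \<in> {x. \<forall>y. form ?c x y = 0}" using x mem[of u] by simp
      then show "x \<in> f ` {x. \<forall>y. form ?c x y = 0}" unfolding u by (rule imageI)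
    next
      fix x assume "x \<in> f ` {x. \<forall>y. form ?c x y = 0}"
      then obtain u where "x = f u" "\<forall>y. form ?c u y = 0" by blast
      then show "x \<in> {x. \<forall>y. form ?d x y = 0}" using mem[of u] by simp
    qed
    moreover have "inj_on f (span {x. \<forall>y. form ?c x y = 0})"
      using inj by (rule inj_on_subset) simp
    ultimately have "dim {x. \<forall>y. form ?d x y = 0} = dim {x. \<forall>y. form ?c x y = 0}"
      by (simp only: dim_image_eq[OF lin])
    moreover have "dim {x. \<forall>y. form ?d x y = 0} = card {i. ?d i * \<epsilon> i = 0}"
      by (rule dim_form_kernel) (simp only: Q.c_tau)
    moreover have "dim {x. \<forall>y. form ?c x y = 0} = card {i. ?c i * \<epsilon> i = 0}"
      by (rule dim_form_kernel) (simp only: P.c_tau)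
    ultimately show ?thesis by (simp only:)
  qed
  ultimately show ?thesis by (rule that)
qed

section \<open>Cross ratios and the choice of coordinates\<close>

text \<open>
  Homogeneous coordinates \<open>(pt1 x l, pt2 l)\<close> of the points \<open>\<infinity>, 0, 1, x\<^sub>0, x\<^sub>1, \<dots>\<close> for \<open>l = 0, 1, 2, 3, 4, \<dots>\<close>
\<close>

definition pt1 :: "(nat \<Rightarrow> real) \<Rightarrow> nat \<Rightarrow> real" where
  "pt1 x l = (if l = 0 then 1 else if l = 1 then 0 else if l = 2 then 1 else x (l - 3))"

definition pt2 :: "nat \<Rightarrow> real" where
  "pt2 l = (if l = 0 then 0 else 1)"

definition minor :: "(nat \<Rightarrow> real) \<Rightarrow> nat \<Rightarrow> nat \<Rightarrow> real" where
  "minor x l l' = pt1 x l * pt2 l' - pt1 x l' * pt2 l"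

text \<open>The intervals for different indices \<open>j \<ge> 1\<close> are disjoint and lie
  between 0 and 1/2, so a set of such points determines their numbering.\<close>

definition good_params :: "nat \<Rightarrow> (nat \<Rightarrow> real) \<Rightarrow> bool" where
  "good_params k x \<longleftrightarrow> 2 < x 0 \<and>
     (\<forall>j. 1 \<le> j \<and> j < k \<longrightarrow> (real j - 1) / (2 * real k) < x j \<and> x j < real j / (2 * real k))"

lemma good_params_less:
  assumes "good_params k x" "good_params k y" "1 \<le> i" "i < j" "j < k"
  shows "x i < y j"
proof -
  have "real i / (2 * real k) \<le> (real j - 1) / (2 * real k)"
    using assms(4) by (intro divide_right_mono) auto
  moreover have "x i < real i / (2 * real k)" "(real j - 1) / (2 * real k) < y j"
    using assms by (auto simp: good_params_def)
  ultimately show ?thesis by linarith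
qed

lemma good_params_bounds:
  assumes "good_params k x" "1 \<le> j" "j < k"
  shows "0 < x j" "x j < 1/2"
proof -
  have "0 \<le> (real j - 1) / (2 * real k)" "real j / (2 * real k) \<le> 1/2"
    using assms(2,3) by (auto simp: field_simps)
  moreover have "(real j - 1) / (2 * real k) < x j" "x j < real j / (2 * real k)"
    using assms by (auto simp: good_params_def)
  ultimately show "0 < x j" "x j < 1/2" by linarith+
qed

lemma minor_nonzero:
  assumes "good_params k x" "l < k + 3" "l' < k + 3" "l \<noteq> l'"
  shows "minor x l l' \<noteq> 0"
proof -
  have *: "minor x l l' \<noteq> 0" if "l < l'" "l' < k + 3" for l l'
  proof (cases "l \<le> 2")
    case True
    have "0 < x (l' - 3) \<and> x (l' - 3) \<noteq> 1" if "3 \<le> l'"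
    proof (cases "l' = 3")
      case False
      then have "1 \<le> l' - 3" "l' - 3 < k" using that \<open>l' < k + 3\<close> by auto
      then show ?thesis using good_params_bounds[OF assms(1), of "l' - 3"] by simp
    qed (use assms(1) in \<open>auto simp: good_params_def\<close>)
    then show ?thesis using True \<open>l < l'\<close> by (auto simp: minor_def pt1_def pt2_def)
  next
    case False
    have l': "1 \<le> l' - 3" "l' - 3 < k" "l - 3 < l' - 3" using False that by auto
    have "x (l - 3) \<noteq> x (l' - 3)"
    proof (cases "l = 3")
      case True
      then show ?thesis using good_params_bounds[OF assms(1) l'(1,2)] assms(1)
        by (simp add: good_params_def)
    next
      case False
      then have "1 \<le> l - 3" using \<open>\<not> l \<le> 2\<close> by simp
      then show ?thesis using good_params_less[OF assms(1,1) _ l'(3,2)] by simp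
    qed
    then show ?thesis using False that by (auto simp: minor_def pt1_def pt2_def)
  qed
  have "minor x l l' = - minor x l' l" by (simp add: minor_def)
  then show ?thesis using *[of l l'] *[of l' l] assms(2-4) by (cases "l < l'") auto
qed

text \<open>
  \<open>B\<close> sends the lines through \<open>\<lambda>\<^sub>0, \<lambda>\<^sub>1, \<lambda>\<^sub>2, \<lambda>\<^sub>3\<close> to those through \<open>(1,0)\<close>, \<open>(0,1)\<close>, \<open>(1,1)\<close>, \<open>(u,1)\<close>,
  whose cross ratio is \<open>u\<close>.
\<close>

lemma cross_ratio_transfer:
  fixes p q r s :: real
  assumes "p * s \<noteq> q * r"
    and "r * a0 + s * b0 = 0" "p * a1 + q * b1 = 0"
    and "p * a2 + q * b2 = r * a2 + s * b2" "p * a3 + q * b3 = u * (r * a3 + s * b3)"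
  shows "(a0 * b2 - a2 * b0) * (a1 * b3 - a3 * b1) = u * (a0 * b3 - a3 * b0) * (a1 * b2 - a2 * b1)"
proof -
  \<comment> \<open>The matrix multiplies each minor by its determinant, so the squared determinant
    turns both sides into products of minors of the image points.\<close>
  have "(p * s - q * r) ^ 2 * ((a0 * b2 - a2 * b0) * (a1 * b3 - a3 * b1))
      = (p * s - q * r) ^ 2 * (u * (a0 * b3 - a3 * b0) * (a1 * b2 - a2 * b1))"
    using assms(2-5) by algebra
  then show ?thesis using assms(1) by simp
qed

text \<open>Among the six cross ratios \<open>x 0\<close>, \<open>1 / x 0\<close>,
  \<open>1 - x 0\<close>, \<open>1 / (1 - x 0)\<close>, \<open>x 0 / (x 0 - 1)\<close> and
  \<open>(x 0 - 1) / x 0\<close>, only the first exceeds 2. The orderings that attain it form the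
  Klein four-group.\<close>

lemma cross_ratio_klein:
  assumes "x 0 > 2" "u > 2"
    and "l0 < 4" "l1 < 4" "l2 < 4" "l3 < 4" "distinct [l0, l1, l2, l3]"
    and "minor x l0 l2 * minor x l1 l3 = u * minor x l0 l3 * minor x l1 l2"
  shows "u = x 0" "(l0, l1, l2) \<in> {(0,1,2), (1,0,3), (2,3,0), (3,2,1)}"
proof -
  \<comment> \<open>In particular this excludes \<open>x 0 * u = x 0 + u\<close>, the equation for
    \<open>u = x 0 / (x 0 - 1)\<close>.\<close>
  have "(x 0 - 2) * (u - 2) > 0" using assms by simp
  then have *: "x 0 * u > 2 * x 0 + 2 * u - 4" by (simp add: algebra_simps)
  have "l \<in> {0,1,2,3}" if "l < 4" for l :: nat using that by auto
  then have "l0 \<in> {0,1,2,3}" "l1 \<in> {0,1,2,3}" "l2 \<in> {0,1,2,3}" "l3 \<in> {0,1,2,3}"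
    using assms by auto
  then have "u = x 0 \<and> (l0, l1, l2) \<in> {(0,1,2), (1,0,3), (2,3,0), (3,2,1)}"
    using assms(1,2,7,8) *
    by (elim insertE emptyE; simp add: minor_def pt1_def pt2_def algebra_simps)
  then show "u = x 0" "(l0, l1, l2) \<in> {(0,1,2), (1,0,3), (2,3,0), (3,2,1)}" by auto
qed

text \<open>With \<open>p = x (l - 3)\<close>, the four orderings give for \<open>v\<close> the
  values \<open>p\<close>, \<open>x 0 / p\<close>, \<open>(x 0 - p) / (1 - p)\<close> and
  \<open>x 0 * (1 - p) / (x 0 - p)\<close>; all but the first exceed 1/2.\<close>

lemma fifth_point_fixed:
  assumes "x 0 > 2" "0 < v" "v < 1/2" "l \<ge> 4" "0 < x (l - 3)" "x (l - 3) < 1/2"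
    and "(l0, l1, l2) \<in> {(0,1,2), (1,0,3), (2,3,0), (3,2,1)}"
    and "minor x l0 l2 * minor x l1 l = v * minor x l0 l * minor x l1 l2"
  shows "v = x (l - 3)"
proof -
  let ?p = "x (l - 3)"
  have "v * ?p < 1/2 * (1/2)" using assms by (intro mult_strict_mono) auto
  moreover have "x 0 * (1 - v - ?p) > 0" "v * ?p > 0" using assms by auto
  ultimately have *: "v * ?p < 1/4" "x 0 * v + x 0 * ?p < x 0" "v * ?p > 0"
    by (simp_all add: algebra_simps)
  from assms(7) consider "l0 = 0" "l1 = 1" "l2 = 2" | "l0 = 1" "l1 = 0" "l2 = 3"
    | "l0 = 2" "l1 = 3" "l2 = 0" | "l0 = 3" "l1 = 2" "l2 = 1" by auto
  then show ?thesis
  proof cases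
    case 1
    then show ?thesis using assms(4,8) by (simp add: minor_def pt1_def pt2_def)
  next
    case 2
    then have "x 0 = v * ?p" using assms(4,8) by (simp add: minor_def pt1_def pt2_def algebra_simps)
    then show ?thesis using * assms(1) by linarith
  next
    case 3
    then have "v + ?p = x 0 + v * ?p" using assms(4,8) by (simp add: minor_def pt1_def pt2_def algebra_simps)
    then show ?thesis using * assms(1,3,6) by linarith
  next
    case 4
    then have "x 0 + v * ?p = x 0 * v + x 0 * ?p"
      using assms(4,8) by (simp add: minor_def pt1_def pt2_def algebra_simps)
    then show ?thesis using * by linarith
  qed
qed

section \<open>Numbering of the coordinates and planes\<close>

lemma div_2_eq_iff: "m div 2 = a \<longleftrightarrow> 2 * a \<le> m \<and> m < 2 * a + 2"
  for m a :: nat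
  by auto

text \<open>
  The label of the coordinate \<open>m \<ge> 2\<close>: the labels \<open>0, 1, 2, 3\<close> are used for one plane (two coordinates),
  the labels \<open>l \<ge> 4\<close> for two planes.
\<close>

definition plane_index :: "nat \<Rightarrow> nat" where
  "plane_index m = (if m div 2 < 5 then m div 2 - 1 else (m div 2 - 5) div 2 + 4)"

lemma plane_index_less:
  assumes "m < 4 * k + 6" "k \<ge> 1"
  shows "plane_index m < k + 3"
proof -
  have "m div 2 < 2 * k + 3" using assms(1) by simp
  then have "(m div 2 - 5) div 2 < k - 1" if "\<not> m div 2 < 5"
    using that by (intro less_mult_imp_div_less) linarith
  then show ?thesis using assms(2) by (auto simp: plane_index_def)
qed

lemma plane_index_eq_iff_simple:
  assumes "l < 4" "2 \<le> m"
  shows "plane_index m = l \<longleftrightarrow> 2 * l + 2 \<le> m \<and> m < 2 * l + 4"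
proof -
  have "1 \<le> m div 2" using assms(2) by simp
  then have "plane_index m = l \<longleftrightarrow> m div 2 = l + 1" using assms(1) unfolding plane_index_def by auto
  then show ?thesis by (simp only: div_2_eq_iff) auto
qed

lemma plane_index_eq_iff_double:
  assumes "4 \<le> l"
  shows "plane_index m = l \<longleftrightarrow> 4 * l - 6 \<le> m \<and> m < 4 * l - 2"
proof -
  have "plane_index m = l \<longleftrightarrow> m div 2 \<ge> 5 \<and> (m div 2 - 5) div 2 = l - 4"
    using assms unfolding plane_index_def by auto
  also have "\<dots> \<longleftrightarrow> 2 * l - 3 \<le> m div 2 \<and> m div 2 < 2 * l - 1"
    unfolding div_2_eq_iff using assms by linarith
  also have "\<dots> \<longleftrightarrow> 4 * l - 6 \<le> m \<and> m < 4 * l - 2"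
    using assms by linarith
  finally show ?thesis .
qed

lemma plane_index_fibre:
  assumes "l < k + 3" "1 \<le> k"
  shows "{m. m < 4 * k + 6 \<and> 2 \<le> m \<and> plane_index m = l}
    = (if l < 4 then {2 * l + 2..<2 * l + 4} else {4 * l - 6..<4 * l - 2})"
proof (rule Set.set_eqI)
  fix m
  show "m \<in> {m. m < 4 * k + 6 \<and> 2 \<le> m \<and> plane_index m = l}
    \<longleftrightarrow> m \<in> (if l < 4 then {2 * l + 2..<2 * l + 4} else {4 * l - 6..<4 * l - 2})"
  proof (cases "l < 4")
    case True
    then show ?thesis
      using assms plane_index_eq_iff_simple[OF True, of m] by (cases "2 \<le> m") auto
  next
    case False
    then have "plane_index m = l \<longleftrightarrow> 4 * l - 6 \<le> m \<and> m < 4 * l - 2"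
      by (intro plane_index_eq_iff_double) simp
    then show ?thesis using assms False by auto
  qed
qed

text \<open>Coordinates 0 and 1 are central, and each even number from 2 on forms a plane with its
  successor. The count is 2 central coordinates, 8 for the labels below 4 and 4 for each of the
  \<open>k - 1\<close> other labels.\<close>

lemma exists_plane_frame:
  assumes "CARD('n::finite) = 4 * k + 6" "k \<ge> 1"
  obtains z1 z2 :: "'n::finite" and \<tau> \<epsilon> lab where
    "plane_frame z1 z2 \<tau> \<epsilon>" "\<tau> z1 = z1" "\<tau> z2 = z2" "\<And>i. lab (\<tau> i) = lab i"
    "\<And>i. \<epsilon> i \<noteq> 0 \<Longrightarrow> lab i < k + 3"
    "\<And>l. l < k + 3 \<Longrightarrow> card {i. \<epsilon> i \<noteq> 0 \<and> lab i = l} = (if l < 4 then 2 else 4)"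
proof -
  obtain e :: "'n \<Rightarrow> nat" where e: "bij_betw e UNIV {..<4 * k + 6}"
    using ex_bij_betw_finite_nat[of "UNIV :: 'n set"] assms(1) by (auto simp: atLeast0LessThan)
  define h where "h = inv_into UNIV e"
  have eh [simp]: "e (h m) = m" if "m < 4 * k + 6" for m
    using bij_betw_inv_into_right[OF e] that by (simp add: h_def)
  have he [simp]: "h (e i) = i" for i
    using bij_betw_inv_into_left[OF e] by (simp add: h_def)
  have e_less [simp]: "e i < 4 * k + 6" for i using e by (auto simp: bij_betw_def)
  define swap where "swap m = (if m < 2 then m else if even m then m + 1 else m - 1)" for m :: nat
  define sg where "sg m = (if m < 2 then 0 else if even m then 1 else - 1 :: real)" for m :: nat
  have swap_less: "swap m < 4 * k + 6" if "m < 4 * k + 6" for m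
    using that unfolding swap_def by presburger
  have swap_swap: "swap (swap m) = m" for m unfolding swap_def by presburger
  have "swap m div 2 = m div 2" for m unfolding swap_def by presburger
  then have plane_index_swap: "plane_index (swap m) = plane_index m" for m by (simp add: plane_index_def)
  have sg_swap: "sg (swap m) = - sg m" for m
  proof -
    have "swap m < 2 \<longleftrightarrow> m < 2" "2 \<le> m \<Longrightarrow> even (swap m) \<longleftrightarrow> odd m" unfolding swap_def by presburger+
    then show ?thesis by (auto simp: sg_def)
  qed
  define \<tau> where "\<tau> i = h (swap (e i))" for i
  have e_tau: "e (\<tau> i) = swap (e i)" for i by (simp add: \<tau>_def swap_less)
  have h_eq: "i = h m \<longleftrightarrow> e i = m" if "m < 4 * k + 6" for i m using that by auto
  show ?thesis
  proof (rule that[of "h 0" "h 1" \<tau> "\<lambda>i. sg (e i)" "\<lambda>i. plane_index (e i)"])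
    show "plane_frame (h 0) (h 1) \<tau> (\<lambda>i. sg (e i))"
    proof
      have "e (h 0) \<noteq> e (h 1)" by simp
      then show "h 0 \<noteq> h 1" by metis
      show "\<tau> (\<tau> i) = i" for i by (simp add: \<tau>_def swap_less swap_swap)
      show "sg (e (\<tau> i)) = - sg (e i)" for i by (simp add: e_tau sg_swap)
      show "i \<noteq> h 0 \<Longrightarrow> i \<noteq> h 1 \<Longrightarrow> sg (e i) * sg (e i) = 1" for i
        by (auto simp: h_eq sg_def less_2_cases_iff)
    qed (simp_all add: sg_def)
    show "\<tau> (h 0) = h 0" "\<tau> (h 1) = h 1" by (simp_all add: \<tau>_def swap_def)
    show "plane_index (e (\<tau> i)) = plane_index (e i)" for i by (simp add: e_tau plane_index_swap)
    show "sg (e i) \<noteq> 0 \<Longrightarrow> plane_index (e i) < k + 3" for i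
      by (intro plane_index_less e_less assms(2))
    fix l assume l: "l < k + 3"
    let ?A = "{m. m < 4 * k + 6 \<and> 2 \<le> m \<and> plane_index m = l}"
    have "{i. sg (e i) \<noteq> 0 \<and> plane_index (e i) = l} = h ` ?A"
    proof (intro equalityI subsetI)
      fix i assume "i \<in> {i. sg (e i) \<noteq> 0 \<and> plane_index (e i) = l}"
      then have "e i \<in> ?A" by (auto simp: sg_def split: if_splits)
      then have "h (e i) \<in> h ` ?A" by (rule imageI)
      then show "i \<in> h ` ?A" by simp
    qed (auto simp: sg_def)
    moreover have "inj_on h ?A" by (rule inj_on_inverseI[where g = e]) simp
    ultimately have "card {i. sg (e i) \<noteq> 0 \<and> plane_index (e i) = l} = card ?A"
      by (simp add: card_image)
    also have "?A = (if l < 4 then {2 * l + 2..<2 * l + 4} else {4 * l - 6..<4 * l - 2})"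
      using l assms(2) by (rule plane_index_fibre)
    also have "card \<dots> = (if l < 4 then 2 else 4)" by auto
    finally show "card {i. sg (e i) \<noteq> 0 \<and> plane_index (e i) = l} = (if l < 4 then 2 else 4)" .
  qed
qed

section \<open>Families of groups and metrics\<close>

context plane_frame
begin

lemma smooth_family_on_form:
  assumes "\<And>i. continuous_on T (\<lambda>t. c t i)"
  shows "smooth_family_on (T \<times> UNIV) (\<lambda>t z. form (c t) (fst z) (snd z))"
proof -
  have "bounded_linear (\<lambda>z :: (real^'n) \<times> (real^'n). \<epsilon> i * fst z $ \<tau> i)" for i
    by (intro bounded_linear_const_mult bounded_linear_compose[OF bounded_linear_vec_nth bounded_linear_fst])
  moreover have "bounded_linear (\<lambda>z :: (real^'n) \<times> (real^'n). snd z $ i)" for i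
    by (rule bounded_linear_compose[OF bounded_linear_vec_nth bounded_linear_snd])
  ultimately show ?thesis
    unfolding form_def J_nth
    by (intro smooth_family_on_sum smooth_family_on_mult smooth_family_on_const smooth_family_on_linear assms)
qed

lemma lie_group_family_pencil:
  assumes p: "\<And>t. pencil z1 z2 \<tau> \<epsilon> (c1 t) (c2 t)"
    and c: "\<And>i. continuous_on T (\<lambda>t. c1 t i)" "\<And>i. continuous_on T (\<lambda>t. c2 t i)"
  shows "lie_group_family T chart_space (\<lambda>t. pencil.grp z1 z2 \<tau> \<epsilon> (c1 t) (c2 t))"
proof -
  have "smooth_family_on (T \<times> UNIV) (\<lambda>t z. (fst z + snd z) + (1/2) *\<^sub>R
      (form (c1 t) (fst z) (snd z) *\<^sub>R axis z1 1 + form (c2 t) (fst z) (snd z) *\<^sub>R axis z2 1))"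
    by (intro smooth_family_on_add smooth_family_on_linear bounded_linear_fst bounded_linear_snd
        smooth_family_on_compose_linear[OF bounded_linear_scaleR_right] smooth_family_on_scaleR
        smooth_family_on_form smooth_family_on_const c continuous_on_const)
  then have mul: "smooth_family_on (T \<times> UNIV) (\<lambda>t (x, y). x \<otimes>\<^bsub>pencil.grp z1 z2 \<tau> \<epsilon> (c1 t) (c2 t)\<^esub> y)"
    by (simp add: pencil.grp_simps[OF p] pencil.mul_def[OF p] pencil.br_def[OF p] case_prod_unfold)
  have inv: "smooth_family_on (T \<times> UNIV) (\<lambda>t. m_inv (pencil.grp z1 z2 \<tau> \<epsilon> (c1 t) (c2 t)))"
  proof -
    have "(\<lambda>t. m_inv (pencil.grp z1 z2 \<tau> \<epsilon> (c1 t) (c2 t))) = (\<lambda>t. uminus)"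
      by (simp add: pencil.inv_grp[OF p] fun_eq_iff)
    then show ?thesis
      using smooth_family_on_linear[OF bounded_linear_minus[OF bounded_linear_ident]] by simp
  qed
  let ?G = "\<lambda>t. pencil.grp z1 z2 \<tau> \<epsilon> (c1 t) (c2 t)"
  have 1: "lie_group chart_space (?G t)" if "t \<in> T" for t
    unfolding lie_group_def prod_chart_space smooth_map_chart_space
  proof (intro conjI smooth_manifold_chart_space pencil.group_grp[OF p])
    show "carrier (?G t) = topspace (mtop chart_space)" by (simp add: pencil.grp_simps(1)[OF p])
    show "smooth_on UNIV (\<lambda>(x, y). x \<otimes>\<^bsub>?G t\<^esub> y)"
      using smooth_family_on_imp_smooth_on[OF mul that] .
    show "smooth_on UNIV (m_inv (?G t))"
      using smooth_family_on_imp_smooth_on[OF inv that] .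
  qed
  have 2: "smooth_map_family T (prod_manifold chart_space chart_space) chart_space
      (\<lambda>t (x, y). x \<otimes>\<^bsub>?G t\<^esub> y)"
    unfolding prod_chart_space by (rule smooth_map_family_chart_space[OF mul])
  have 3: "smooth_map_family T chart_space chart_space (\<lambda>t. m_inv (?G t))"
    by (rule smooth_map_family_chart_space[OF inv])
  show ?thesis unfolding lie_group_family_def by (intro conjI ballI 1 2 3)
qed

end

definition frame_weights :: "'n \<Rightarrow> 'n \<Rightarrow> real^3 \<Rightarrow> 'n \<Rightarrow> real" where
  "frame_weights z1 z2 s i = (if i = z1 then s $ 1 else if i = z2 then s $ 2 else s $ 3)"

context pencil
begin

lemma metric_family_weights:
  assumes weighted: "\<And>s. s \<in> S \<Longrightarrow> weighted_pencil z1 z2 \<tau> \<epsilon> c1 c2 (frame_weights z1 z2 s)"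
  shows "metric_family S chart_space
    (\<lambda>s p c. weighted_pencil.met z1 z2 \<tau> \<epsilon> c1 c2 (frame_weights z1 z2 s) p)"
proof -
  have "smooth_family_on (S \<times> UNIV)
     (\<lambda>s x. weighted_pencil.met z1 z2 \<tau> \<epsilon> c1 c2 (frame_weights z1 z2 s) x u v)" (is "smooth_family_on _ ?f") for u v
  proof -
    let ?g = "\<lambda>s x. \<Sum>i\<in>UNIV. frame_weights z1 z2 s i * (theta x u $ i) * (theta x v $ i)"
    have "continuous_on S (\<lambda>s. frame_weights z1 z2 s i)" for i
      unfolding frame_weights_def
      by (cases "i = z1"; cases "i = z2") (auto intro!: continuous_intros)
    then have sm: "smooth_family_on (S \<times> UNIV) ?g"
      by (intro smooth_family_on_sum smooth_family_on_mult smooth_family_on_const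
          smooth_family_on_compose_linear[OF bounded_linear_vec_nth] smooth_family_on_theta)
    have eq: "?f s = ?g s" if "s \<in> S" for s
      unfolding weighted_pencil.met_def[OF weighted[OF that]] weighted_pencil.ip_def[OF weighted[OF that]] ..
    show ?thesis
      by (rule smooth_family_on_cong[of S ?f ?g, THEN iffD2, OF _ sm]) (rule eq)
  qed
  then show ?thesis
    unfolding metric_family_def chart_space_simps
    using weighted_pencil.riemannian_metric_met[OF weighted] by simp
qed

end

section \<open>Recovering the parameters from the isomorphism class\<close>

locale labelled_frame = plane_frame z1 z2 \<tau> \<epsilon>
  for z1 z2 :: "'n::finite" and \<tau> \<epsilon> +
  fixes lab :: "'n \<Rightarrow> nat" and k :: nat
  assumes k_pos: "1 \<le> k" and tau_z: "\<tau> z1 = z1" "\<tau> z2 = z2"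
    and lab_tau [simp]: "lab (\<tau> i) = lab i"
    and lab_less: "\<epsilon> i \<noteq> 0 \<Longrightarrow> lab i < k + 3"
    and card_lab: "l < k + 3 \<Longrightarrow> card {i. \<epsilon> i \<noteq> 0 \<and> lab i = l} = (if l < 4 then 2 else 4)"
begin

text \<open>The label of a plane tells which of the points \<open>\<infinity>\<close>, 0, 1,
  \<open>x 0\<close>, \<open>x 1\<close>, ... is the line of its vector in z.\<close>

definition coef1 :: "(nat \<Rightarrow> real) \<Rightarrow> 'n \<Rightarrow> real" where
  "coef1 x i = (if \<epsilon> i = 0 then 0 else pt1 x (lab i))"

definition coef2 :: "'n \<Rightarrow> real" where
  "coef2 i = (if \<epsilon> i = 0 then 0 else pt2 (lab i))"

lemma pencil_coef: "pencil z1 z2 \<tau> \<epsilon> (coef1 x) coef2"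
  by unfold_locales (simp_all add: coef1_def coef2_def)

lemma exists_label: "l < k + 3 \<Longrightarrow> \<exists>i. \<epsilon> i \<noteq> 0 \<and> lab i = l"
proof (rule ccontr)
  assume l: "l < k + 3" and "\<not> (\<exists>i. \<epsilon> i \<noteq> 0 \<and> lab i = l)"
  then have empty: "{i. \<epsilon> i \<noteq> 0 \<and> lab i = l} = {}" by blast
  have "0 = (if l < 4 then 2 else 4 :: nat)" using card_lab[OF l] unfolding empty card.empty .
  then show False by (simp split: if_splits)
qed

lemma weighted_pencil_coef:
  assumes "\<And>i. s $ i > 0"
  shows "weighted_pencil z1 z2 \<tau> \<epsilon> (coef1 x) coef2 (frame_weights z1 z2 s)"
proof -
  have "\<tau> i = z1 \<longleftrightarrow> i = z1" "\<tau> i = z2 \<longleftrightarrow> i = z2" for i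
    using tau_z tau_tau by metis+
  then show ?thesis
    using assms pencil_coef
    by (auto simp: weighted_pencil_def weighted_pencil_axioms_def frame_weights_def)
qed

text \<open>A nonzero functional killing the vector with label \<open>l\<close> kills no other,
  because the minors are nonzero. The radical consists of z and the planes labelled
  \<open>l\<close>, of dimension 2 + 2 or 2 + 4.\<close>

lemma card_singular:
  assumes x: "good_params k x" and uv: "u \<noteq> 0 \<or> v \<noteq> 0"
    and l: "l < k + 3" "u * pt1 x l + v * pt2 l = 0"
  shows "card {i. (u * coef1 x i + v * coef2 i) * \<epsilon> i = 0} = (if l < 4 then 4 else 6)"
proof -
  have "u * pt1 x l' + v * pt2 l' \<noteq> 0" if "l' < k + 3" "l' \<noteq> l" for l'
  proof
    assume 0: "u * pt1 x l' + v * pt2 l' = 0"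
    have "u * minor x l l' = 0" "v * minor x l l' = 0"
      using l(2) 0 unfolding minor_def by algebra+
    then show False using uv minor_nonzero[OF x l(1) that(1)] that(2) by auto
  qed
  then have "{i. (u * coef1 x i + v * coef2 i) * \<epsilon> i = 0} = {z1, z2} \<union> {i. \<epsilon> i \<noteq> 0 \<and> lab i = l}"
    using l(2) lab_less by (auto simp: coef1_def coef2_def eps_eq_0_iff)
  moreover have "{z1, z2} \<inter> {i. \<epsilon> i \<noteq> 0 \<and> lab i = l} = {}" by auto
  ultimately show ?thesis
    using card_Un_disjoint[of "{z1, z2}" "{i. \<epsilon> i \<noteq> 0 \<and> lab i = l}"] card_lab[OF l(1)] z_distinct
    by simp
qed

lemma singular_exists:
  assumes "card {i. (u * coef1 x i + v * coef2 i) * \<epsilon> i = 0} > 2"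
  obtains l where "l < k + 3" "u * pt1 x l + v * pt2 l = 0"
proof -
  have "\<exists>i. \<epsilon> i \<noteq> 0 \<and> u * coef1 x i + v * coef2 i = 0"
  proof (rule ccontr)
    assume "\<not> ?thesis"
    then have "{i. (u * coef1 x i + v * coef2 i) * \<epsilon> i = 0} \<subseteq> {z1, z2}"
      by (auto simp: eps_eq_0_iff)
    then have "card {i. (u * coef1 x i + v * coef2 i) * \<epsilon> i = 0} \<le> card {z1, z2}"
      by (intro card_mono) auto
    then show False using assms z_distinct by simp
  qed
  then obtain i where "\<epsilon> i \<noteq> 0" "u * pt1 x (lab i) + v * pt2 (lab i) = 0"
    by (auto simp: coef1_def coef2_def)
  then show ?thesis using that[OF lab_less] by blast
qed

text \<open>Radicals larger than z must correspond, so each point \<open>l\<close> of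
  \<open>y\<close> is the image of a point \<open>\<sigma> l\<close> of \<open>x\<close> of the same
  multiplicity. The points of multiplicity one give \<open>x 0 = y 0\<close> by their cross ratio
  and restrict \<open>\<sigma>\<close> on them to a Klein permutation, which then controls the
  others.\<close>

lemma lie_isomorphic_imp_eq_params:
  assumes x: "good_params k x" and y: "good_params k y"
    and iso: "lie_isomorphic chart_space (pencil.grp z1 z2 \<tau> \<epsilon> (coef1 x) coef2)
                chart_space (pencil.grp z1 z2 \<tau> \<epsilon> (coef1 y) coef2)"
    and j: "j < k"
  shows "x j = y j"
proof -
  obtain i0 i1 where i: "\<epsilon> i0 \<noteq> 0" "lab i0 = 0" "\<epsilon> i1 \<noteq> 0" "lab i1 = 1"
    using exists_label[of 0] exists_label[of 1] by auto
  have coef: "coef1 x i0 = 1" "coef2 i0 = 0" "coef1 x i1 = 0" "coef2 i1 = 1"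
    using i by (simp_all add: coef1_def coef2_def pt1_def pt2_def)
  have "\<exists>p q r s. p * s \<noteq> q * r \<and>
      (\<forall>u v. card {i. ((u * p + v * r) * coef1 x i + (u * q + v * s) * coef2 i) * \<epsilon> i = 0}
           = card {i. (u * coef1 y i + v * coef2 i) * \<epsilon> i = 0})"
    by (rule lie_isomorphic_imp_equivalent_pencils[OF pencil_coef pencil_coef iso i(1) coef(1,2) i(3) coef(3,4)])
      blast
  then obtain p q r s where det: "p * s \<noteq> q * r" and
    card_eq: "\<And>u v. card {i. ((u * p + v * r) * coef1 x i + (u * q + v * s) * coef2 i) * \<epsilon> i = 0}
         = card {i. (u * coef1 y i + v * coef2 i) * \<epsilon> i = 0}"
    by blast
  define V1 V2 where "V1 l = p * pt1 x l + q * pt2 l" and "V2 l = r * pt1 x l + s * pt2 l" for l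
  have "\<exists>l<k + 3. (l < 4 \<longleftrightarrow> l' < 4) \<and> pt2 l' * V1 l = pt1 y l' * V2 l" if l': "l' < k + 3" for l'
  proof -
    \<comment> \<open>The functional on z whose kernel is the point \<open>l'\<close> of
      \<open>y\<close>.\<close>
    let ?u = "pt2 l'" and ?v = "- pt1 y l'"
    have uv: "?u \<noteq> 0 \<or> ?v \<noteq> 0" by (simp add: pt1_def pt2_def)
    have nz: "?u * p + ?v * r \<noteq> 0 \<or> ?u * q + ?v * s \<noteq> 0"
    proof (rule ccontr)
      assume "\<not> ?thesis"
      then have "?u * (p * s - q * r) = 0" "?v * (p * s - q * r) = 0" by algebra+
      then show False using uv det by auto
    qed
    have card': "card {i. ((?u * p + ?v * r) * coef1 x i + (?u * q + ?v * s) * coef2 i) * \<epsilon> i = 0}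
        = (if l' < 4 then 4 else 6)"
      unfolding card_eq by (rule card_singular[OF y uv l']) simp
    then obtain l where l: "l < k + 3" "(?u * p + ?v * r) * pt1 x l + (?u * q + ?v * s) * pt2 l = 0"
      using singular_exists[of "?u * p + ?v * r" x "?u * q + ?v * s"] by (auto split: if_splits)
    have "(if l < 4 then 4 else 6 :: nat) = (if l' < 4 then 4 else 6)"
      using card_singular[OF x nz l] card' by simp
    then have "l < 4 \<longleftrightarrow> l' < 4" by (auto split: if_splits)
    moreover have "pt2 l' * V1 l = pt1 y l' * V2 l"
      using l(2) by (simp add: V1_def V2_def algebra_simps)
    ultimately show ?thesis using l(1) by blast
  qed
  then obtain \<sigma> where \<sigma>: "\<And>l. l < k + 3 \<Longrightarrow> \<sigma> l < k + 3"
    "\<And>l. l < k + 3 \<Longrightarrow> \<sigma> l < 4 \<longleftrightarrow> l < 4" "\<And>l. l < k + 3 \<Longrightarrow> pt2 l * V1 (\<sigma> l) = pt1 y l * V2 (\<sigma> l)"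
    by metis
  \<comment> \<open>Otherwise one image vector would be proportional to two distinct points of
    \<open>y\<close>, hence zero, although the matrix is invertible.\<close>
  have \<sigma>_inj: "\<sigma> l \<noteq> \<sigma> l'" if "l < k + 3" "l' < k + 3" "l \<noteq> l'" for l l'
  proof
    assume eq: "\<sigma> l = \<sigma> l'"
    have "minor y l l' * V1 (\<sigma> l) = 0" "minor y l l' * V2 (\<sigma> l) = 0"
      using \<sigma>(3)[OF that(1)] \<sigma>(3)[OF that(2)] unfolding eq minor_def by algebra+
    then have "V1 (\<sigma> l) = 0" "V2 (\<sigma> l) = 0" using minor_nonzero[OF y that] by auto
    then have "(p * s - q * r) * pt1 x (\<sigma> l) = 0" "(p * s - q * r) * pt2 (\<sigma> l) = 0"
      unfolding V1_def V2_def by algebra+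
    then show False using det by (auto simp: pt1_def pt2_def split: if_splits)
  qed
  have le: "l < k + 3" if "l < 4" for l using that k_pos by simp
  have pts: "V2 (\<sigma> 0) = 0" "V1 (\<sigma> 1) = 0" "V1 (\<sigma> 2) = V2 (\<sigma> 2)"
    using \<sigma>(3)[of 0] \<sigma>(3)[of 1] \<sigma>(3)[of 2] by (simp_all add: pt1_def pt2_def)
  have V_affine: "V1 (\<sigma> l) = y (l - 3) * V2 (\<sigma> l)" if "3 \<le> l" "l < k + 3" for l
    using \<sigma>(3)[OF that(2)] that by (simp add: pt1_def pt2_def)
  \<comment> \<open>\<open>y (l - 3)\<close> is the cross ratio of the points 0, 1, 2 and
    \<open>l\<close> of \<open>y\<close>, and linear maps of z preserve cross ratios.\<close>
  have cr: "minor x (\<sigma> 0) (\<sigma> 2) * minor x (\<sigma> 1) (\<sigma> l)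
      = y (l - 3) * minor x (\<sigma> 0) (\<sigma> l) * minor x (\<sigma> 1) (\<sigma> 2)" if "3 \<le> l" "l < k + 3" for l
    unfolding minor_def
    by (rule cross_ratio_transfer[OF det]) (use pts V_affine[OF that] in \<open>simp_all add: V1_def V2_def\<close>)
  have "2 < x 0" "2 < y 0" using x y by (auto simp: good_params_def)
  note klein = cross_ratio_klein[where x = x and u = "y 0", OF this, of "\<sigma> 0" "\<sigma> 1" "\<sigma> 2" "\<sigma> 3"]
  have "\<sigma> l \<noteq> \<sigma> l'" if "l < 4" "l' < 4" "l \<noteq> l'" for l l'
    using \<sigma>_inj[OF le le] that by blast
  then have "distinct [\<sigma> 0, \<sigma> 1, \<sigma> 2, \<sigma> 3]" by simp
  moreover have "\<sigma> 0 < 4" "\<sigma> 1 < 4" "\<sigma> 2 < 4" "\<sigma> 3 < 4"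
    using \<sigma>(2)[OF le] by simp_all
  moreover have "minor x (\<sigma> 0) (\<sigma> 2) * minor x (\<sigma> 1) (\<sigma> 3) = y 0 * minor x (\<sigma> 0) (\<sigma> 3) * minor x (\<sigma> 1) (\<sigma> 2)"
    using cr[of 3] k_pos by simp
  ultimately have y0: "y 0 = x 0"
    and perm: "(\<sigma> 0, \<sigma> 1, \<sigma> 2) \<in> {(0,1,2), (1,0,3), (2,3,0), (3,2,1)}"
    using klein by blast+
  show ?thesis
  proof (cases "j = 0")
    case True
    then show ?thesis using y0 by simp
  next
    case False
    define l where "l = j + 3"
    have l: "4 \<le> l" "l < k + 3" "l - 3 = j" using False j by (auto simp: l_def)
    define i where "i = \<sigma> l - 3"
    have "4 \<le> \<sigma> l" "\<sigma> l < k + 3" using \<sigma>(1,2)[OF l(2)] l(1) by auto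
    then have i: "1 \<le> i" "i < k" by (auto simp: i_def)
    have j1: "1 \<le> j" using False by simp
    have "y j = x i"
      unfolding i_def
    proof (rule fifth_point_fixed[where x = x, OF \<open>2 < x 0\<close> _ _ \<open>4 \<le> \<sigma> l\<close> _ _ perm])
      show "0 < y j" "y j < 1/2" using good_params_bounds[OF y j1 j] by auto
      show "0 < x (\<sigma> l - 3)" "x (\<sigma> l - 3) < 1/2" using good_params_bounds[OF x i] by (auto simp: i_def)
      show "minor x (\<sigma> 0) (\<sigma> 2) * minor x (\<sigma> 1) (\<sigma> l) = y j * minor x (\<sigma> 0) (\<sigma> l) * minor x (\<sigma> 1) (\<sigma> 2)"
        using cr[of l] l by simp
    qed
    \<comment> \<open>Parameters with different indices from 1 on lie in disjoint intervals, so
      \<open>y j = x i\<close> forces equal indices.\<close>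
    moreover have "i = j"
      using good_params_less[OF x y i(1) _ j] good_params_less[OF y x j1 _ i(2)] calculation
      by (cases i j rule: linorder_cases) auto
    ultimately show ?thesis by simp
  qed
qed

end

section \<open>Assembly of the families of groups and metrics\<close>

lemma exists_labelled_frame:
  assumes "CARD('n::finite) = 4 * k + 6" "k \<ge> 1"
  obtains z1 z2 :: "'n::finite" and \<tau> \<epsilon> lab where "labelled_frame z1 z2 \<tau> \<epsilon> lab k"
proof (rule exists_plane_frame[OF assms])
  fix z1 z2 :: 'n and \<tau> \<epsilon> lab
  assume "plane_frame z1 z2 \<tau> \<epsilon>" "\<tau> z1 = z1" "\<tau> z2 = z2" "\<And>i. lab (\<tau> i) = lab i"
    "\<And>i. \<epsilon> i \<noteq> 0 \<Longrightarrow> lab i < k + 3"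
    "\<And>l. l < k + 3 \<Longrightarrow> card {i. \<epsilon> i \<noteq> 0 \<and> lab i = l} = (if l < 4 then 2 else 4)"
  then have "labelled_frame z1 z2 \<tau> \<epsilon> lab k"
    unfolding labelled_frame_def labelled_frame_axioms_def using assms(2) by (intro conjI allI impI)
  then show thesis by (rule that)
qed

theorem theorem2:
  fixes k :: nat
  assumes "k \<ge> 1" and "CARD('k::finite) = k" and "CARD('n::finite) = 4 * k + 6"
  shows "\<exists>(T :: (real^'k) set) (M :: (real^'n, real^'n) manifold) (N :: real^'k \<Rightarrow> (real^'n) monoid).
    open T \<and> T \<noteq> {} \<and>
    lie_group_family T M N \<and>
    connected_space (mtop M) \<and> simply_connected_space (mtop M) \<and>
    (\<forall>t\<in>T. nilpotent_group (N t)) \<and>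
    (\<forall>t\<in>T. \<forall>t'\<in>T. t \<noteq> t' \<longrightarrow> \<not> lie_isomorphic M (N t) M (N t')) \<and>
    (\<forall>t\<in>T. \<exists>(S :: (real^3) set) g.
       open S \<and> S \<noteq> {} \<and>
       metric_family S M g \<and>
       (\<forall>s\<in>S. left_invariant M (N t) (g s) \<and> geodesic_orbit M (g s)) \<and>
       (\<forall>s\<in>S. \<forall>s'\<in>S. s \<noteq> s' \<longrightarrow> \<not> same_metric M (g s) (g s')))"
proof -
  obtain z1 z2 :: 'n and \<tau> \<epsilon> lab where "labelled_frame z1 z2 \<tau> \<epsilon> lab k"
    by (rule exists_labelled_frame[OF assms(3,1)])
  then interpret labelled_frame z1 z2 \<tau> \<epsilon> lab k .
  obtain d :: "'k \<Rightarrow> nat" where d: "bij_betw d UNIV {..<k}"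
    using ex_bij_betw_finite_nat[of "UNIV :: 'k set"] assms(2) by (auto simp: atLeast0LessThan)
  define h where "h = inv_into UNIV d"
  have hd: "h (d i) = i" for i using bij_betw_inv_into_left[OF d] by (simp add: h_def)
  have dh: "d (h j) = j" if "j < k" for j using bij_betw_inv_into_right[OF d] that by (simp add: h_def)
  have d_less: "d i < k" for i using d by (auto simp: bij_betw_def)
  define par where "par t j = t $ h j" for t :: "real^'k" and j
  \<comment> \<open>These intervals are the conditions of \<open>good_params\<close>, which makes
    the parameter set \<open>T\<close> an open box.\<close>
  define U where "U j = (if j = 0 then {2<..} else {(real j - 1) / (2 * real k)<..<real j / (2 * real k)})" for j
  define T where "T = {t :: real^'k. \<forall>i. t $ i \<in> U (d i)}"
  define N where "N t = pencil.grp z1 z2 \<tau> \<epsilon> (coef1 (par t)) coef2" for t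
  have good: "good_params k (par t)" if "t \<in> T" for t
  proof -
    have "par t j \<in> U j" if "j < k" for j
      using \<open>t \<in> T\<close> dh[OF that] unfolding T_def par_def by (metis mem_Collect_eq)
    then show ?thesis using assms(1) unfolding good_params_def U_def by force
  qed
  have "open T"
    unfolding T_def by (rule open_vector_box) (simp add: U_def)
  moreover have "T \<noteq> {}"
  proof -
    have "\<exists>u. u \<in> U j" for j
    proof (cases "j = 0")
      case True
      then show ?thesis by (auto simp: U_def intro: exI[of _ 3])
    next
      case False
      have "(real j - 1) / (2 * real k) < real j / (2 * real k)"
        using assms(1) by (intro divide_strict_right_mono) auto
      then show ?thesis using False dense by (simp add: U_def) blast
    qed
    then obtain u where "\<And>j. u j \<in> U j" by metis
    then have "(\<chi> i. u (d i)) \<in> T" by (simp add: T_def)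
    then show ?thesis by blast
  qed
  moreover have "lie_group_family T chart_space N"
    unfolding N_def
  proof (rule lie_group_family_pencil[OF pencil_coef])
    show "continuous_on T (\<lambda>t. coef1 (par t) i)" for i
      unfolding coef1_def pt1_def par_def
      by (cases "\<epsilon> i = 0"; cases "lab i = 0"; cases "lab i = 1"; cases "lab i = 2")
         (auto intro!: continuous_intros)
  qed simp
  moreover have "connected_space (euclidean :: (real^'n) topology)"
    using simply_connected_euclidean[where 'a = "real^'n"] path_connected_imp_connected_space
    unfolding simply_connected_space_def by blast
  moreover have "nilpotent_group (N t)" for t
    unfolding N_def by (rule pencil.nilpotent_grp[OF pencil_coef])
  moreover have "t = t'" if "t \<in> T" "t' \<in> T" "lie_isomorphic chart_space (N t) chart_space (N t')" for t t'
  proof -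
    have "par t (d i) = par t' (d i)" for i
      using lie_isomorphic_imp_eq_params[OF good[OF that(1)] good[OF that(2)] that(3)[unfolded N_def] d_less] .
    then show ?thesis by (simp add: par_def hd vec_eq_iff)
  qed
  moreover have "\<exists>(S :: (real^3) set) g. open S \<and> S \<noteq> {} \<and> metric_family S chart_space g \<and>
       (\<forall>s\<in>S. left_invariant chart_space (N t) (g s) \<and> geodesic_orbit chart_space (g s)) \<and>
       (\<forall>s\<in>S. \<forall>s'\<in>S. s \<noteq> s' \<longrightarrow> \<not> same_metric chart_space (g s) (g s'))" for t
  proof -
    let ?c1 = "coef1 (par t)"
    define S where "S = {s :: real^3. \<forall>i. s $ i \<in> {0<..}}"
    define g where "g s p c = weighted_pencil.met z1 z2 \<tau> \<epsilon> ?c1 coef2 (frame_weights z1 z2 s) p"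
      for s :: "real^3" and p :: "real^'n" and c :: "(real^'n, real^'n) chart"
    have weighted: "weighted_pencil z1 z2 \<tau> \<epsilon> ?c1 coef2 (frame_weights z1 z2 s)" if "s \<in> S" for s
      using that by (intro weighted_pencil_coef) (simp add: S_def)
    have "open S" unfolding S_def by (rule open_vector_box) simp
    moreover have "1 \<in> S" by (simp add: S_def)
    moreover have "metric_family S chart_space g"
      unfolding g_def[abs_def] by (rule pencil.metric_family_weights[OF pencil_coef weighted])
    moreover have "left_invariant chart_space (N t) (g s)" "geodesic_orbit chart_space (g s)" if "s \<in> S" for s
      unfolding g_def[abs_def] N_def
      using weighted_pencil.left_invariant_met[OF weighted[OF that]]
        weighted_pencil.geodesic_orbit_met[OF weighted[OF that]] by auto
    moreover have "s = s'" if ss: "s \<in> S" "s' \<in> S" and "same_metric chart_space (g s) (g s')" for s s'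
    proof -
      \<comment> \<open>At the identity \<open>theta\<close> is the identity map, so the diagonal
        entries of the metric are the weights.\<close>
      have diag: "g s 0 (UNIV, id) (axis i 1) (axis i 1) = frame_weights z1 z2 s i" if "s \<in> S" for s i
      proof -
        interpret weighted_pencil z1 z2 \<tau> \<epsilon> ?c1 coef2 "frame_weights z1 z2 s"
          by (rule weighted[OF that])
        show ?thesis by (simp add: g_def met_def theta_def br_simps ip_axis)
      qed
      have "g s 0 (UNIV, id) = g s' 0 (UNIV, id)" using that by (simp add: same_metric_def)
      then have w: "frame_weights z1 z2 s i = frame_weights z1 z2 s' i" for i
        using diag[OF ss(1), of i] diag[OF ss(2), of i] by simp
      \<comment> \<open>A coordinate outside z reads off the third weight.\<close>
      obtain i where "\<epsilon> i \<noteq> 0" using exists_label[of 0] by auto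
      then have "s $ 1 = s' $ 1" "s $ 2 = s' $ 2" "s $ 3 = s' $ 3"
        using w[of z1] w[of z2] w[of i] z_distinct by (auto simp: frame_weights_def eps_eq_0_iff)
      then show ?thesis by (simp add: vec_eq_iff forall_3)
    qed
    ultimately show ?thesis by blast
  qed
  ultimately show ?thesis
    using simply_connected_euclidean
    by (intro exI[of _ T] exI[of _ chart_space] exI[of _ N]) auto
qed

end
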